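(* Let $F_2=\langle a,b\rangle$ be the free group on $a,b$ and for $k\ge 1$ let $P_k\subset F_2$ be the subgroup generated by the $k$-th powers of all primitive elements of $F_2$. Then: (i) $P_2$ is the normal closure in $F_2$ of $\{a^2,\ b^2,\ (ab)^2\}$; (ii) $P_3$ is the normal closure in $F_2$ of $\{a^3,\ b^3,\ (ab)^3,\ (ab^{-1})^3\}$; (iii) $P_4$ is the normal closure in $F_2$ of $\{a^4,\ b^4,\ (ab)^4,\ (ab^{-1})^4,\ (a^2b)^4,\ (ab^2)^4\}$; (iv) $P_5$ is the normal closure in $F_2$ of $$\{a^5,\ b^5,\ (ab)^5,\ (ab^{-1})^5,\ (a^2b)^5,\ (ab^2)^5,\ (a^2b^{-1})^5,\ (ab^{-2})^5,\ (a^2bab)^5,\ (ab^{-1}ab^{-2})^5,\ (a^3ba^2b)^5,\ (ab^{-2}ab^{-3})^5\}.$$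
   Context: An element of $F_2$ is primitive if it belongs to some two-element generating set of $F_2$. The subgroup $P_k$ is characteristic, hence normal, in $F_2$. *)

theory Defs
  imports "HOL-Algebra.Generated_Groups"
begin

text \<open>The letter \<open>(x, True)\<close> stands for the generator \<open>x\<close>, and \<open>(x, False)\<close> for its formal inverse.\<close>

type_synonym 'g letter = "'g \<times> bool"

definition inv_letter :: "'g letter \<Rightarrow> 'g letter" where
  "inv_letter l = (fst l, \<not> snd l)"

fun reduced :: "'g letter list \<Rightarrow> bool" where
  "reduced (l # m # w) \<longleftrightarrow> m \<noteq> inv_letter l \<and> reduced (m # w)"
| "reduced _ \<longleftrightarrow> True"

fun push :: "'g letter \<Rightarrow> 'g letter list \<Rightarrow> 'g letter list" where
  "push l [] = [l]"
| "push l (m # w) = (if m = inv_letter l then w else l # m # w)"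

text \<open>For reduced \<open>u\<close> and \<open>v\<close>, \<open>foldr push u v\<close> is the reduced form of the concatenation \<open>u @ v\<close>.\<close>

definition free_group :: "'g letter list monoid" where
  "free_group = \<lparr>carrier = {w. reduced w}, mult = foldr push, one = []\<rparr>"

definition generator :: "'g \<Rightarrow> 'g letter list" where
  "generator x = [(x, True)]"

lemma inv_letter_invol [simp]: "inv_letter (inv_letter l) = l"
  by (simp add: inv_letter_def)

lemma reduced_tl: "reduced (l # w) \<Longrightarrow> reduced w"
  by (cases w) auto

lemma reduced_push: "reduced w \<Longrightarrow> reduced (push l w)"
  by (cases w) (auto dest: reduced_tl)

lemma reduced_foldr_push: "reduced v \<Longrightarrow> reduced (foldr push u v)"
  by (induction u) (auto simp: reduced_push)

lemma push_reduced: "reduced (l # w) \<Longrightarrow> push l w = l # w"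
  by (cases w) auto

lemma foldr_push_Nil: "reduced w \<Longrightarrow> foldr push w [] = w"
proof (induction w)
  case (Cons l w)
  then have "foldr push w [] = w" by (blast dest: reduced_tl)
  with Cons.prems show ?case by (simp add: push_reduced)
qed simp

lemma push_push_inv: "reduced w \<Longrightarrow> push l (push (inv_letter l) w) = w"
  by (cases w) (auto simp: push_reduced)

lemma foldr_push_push:
  "reduced v \<Longrightarrow> foldr push (push l u) v = push l (foldr push u v)"
  by (cases u) (auto simp: push_push_inv reduced_foldr_push)

lemma foldr_push_assoc:
  "reduced w \<Longrightarrow> foldr push (foldr push u v) w = foldr push u (foldr push v w)"
  by (induction u) (auto simp: foldr_push_push)

lemma foldr_push_rev_inv:
  "reduced v \<Longrightarrow> foldr push (map inv_letter (rev w)) (foldr push w v) = v"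
proof (induction w arbitrary: v)
  case (Cons l w)
  then show ?case
    using push_push_inv[of "foldr push w v" "inv_letter l"]
    by (simp add: reduced_foldr_push)
qed simp

lemma group_free_group: "group free_group"
proof (rule groupI)
  fix w :: "'g letter list" assume "w \<in> carrier free_group"
  let ?w' = "foldr push (map inv_letter (rev w)) []"
  have "foldr push ?w' w = []"
    using \<open>w \<in> carrier free_group\<close> foldr_push_rev_inv[of "[]" w]
    by (simp add: free_group_def foldr_push_assoc foldr_push_Nil)
  then show "\<exists>y\<in>carrier free_group. y \<otimes>\<^bsub>free_group\<^esub> w = \<one>\<^bsub>free_group\<^esub>"
    by (intro bexI[of _ ?w']) (simp_all add: free_group_def reduced_foldr_push)
qed (auto simp: free_group_def reduced_foldr_push foldr_push_assoc)

text \<open>The universal property, split into existence and uniqueness (generation).\<close>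

lemma generator_closed: "generator x \<in> carrier free_group"
  by (simp add: free_group_def generator_def)

lemma inv_generator: "inv\<^bsub>free_group\<^esub> (generator x) = [(x, False)]"
proof -
  interpret group "free_group :: 'a letter list monoid" by (rule group_free_group)
  show ?thesis
    by (rule inv_equality) (auto simp: free_group_def generator_def inv_letter_def)
qed

lemma generate_generators: "generate free_group (range generator) = carrier free_group"
proof -
  interpret group "free_group :: 'a letter list monoid" by (rule group_free_group)
  have letter: "[l] \<in> generate free_group (range generator)" for l :: "'a letter"
    using generate.incl[of "generator (fst l)" "range generator" free_group]
          generate.inv[of "generator (fst l)" "range generator" free_group]
    by (cases l; cases "snd l") (auto simp: inv_generator, simp_all add: generator_def)
  have "w \<in> generate free_group (range generator)" if "reduced w" for w :: "'a letter list"
    using that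
  proof (induction w)
    case Nil
    show ?case using generate.one[of free_group] by (simp add: free_group_def)
  next
    case (Cons l w)
    then have "[l] \<otimes>\<^bsub>free_group\<^esub> w \<in> generate free_group (range generator)"
      by (intro generate.eng letter) (auto dest: reduced_tl)
    then show ?case using Cons.prems by (simp add: free_group_def push_reduced)
  qed
  moreover have "generate free_group (range generator) \<subseteq> (carrier free_group :: 'a letter list set)"
    by (intro generate_incl) (auto simp: generator_closed)
  ultimately show ?thesis by (auto simp: free_group_def)
qed

lemma free_group_extend:
  fixes G (structure) and f :: "'g \<Rightarrow> 'a"
  assumes "group G" and f: "\<And>x. f x \<in> carrier G"
  shows "\<exists>h \<in> hom free_group G. \<forall>x. h (generator x) = f x"
proof -
  interpret group G by fact
  define e where "e l = (if snd l then f (fst l) else inv f (fst l))" for l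
  define h where "h = foldr (\<lambda>l z. e l \<otimes> z)"
  have e: "e l \<in> carrier G" for l by (simp add: e_def f)
  have h: "h w \<one> \<in> carrier G" for w by (induction w) (auto simp: h_def e)
  have ee: "e l \<otimes> e (inv_letter l) = \<one>" for l by (simp add: e_def inv_letter_def f)
  have push: "h (push l w) \<one> = e l \<otimes> h w \<one>" for l w
  proof (cases w)
    case (Cons m w')
    have "e l \<otimes> (e (inv_letter l) \<otimes> h w' \<one>) = h w' \<one>"
      using m_assoc[OF e[of l] e[of "inv_letter l"] h[of w']] h[of w'] by (simp add: ee)
    then show ?thesis using Cons by (auto simp: h_def)
  qed (simp add: h_def)
  have "h (foldr push u v) \<one> = h u \<one> \<otimes> h v \<one>" for u v
  proof (induction u)
    case Nil then show ?case using h[of v] by (simp add: h_def)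
  next
    case (Cons l u)
    have "h (l # u) \<one> = e l \<otimes> h u \<one>" by (simp add: h_def)
    then show ?case using Cons m_assoc[OF e[of l] h[of u] h[of v]] by (simp add: push)
  qed
  then have "(\<lambda>w :: 'g letter list. h w \<one>) \<in> hom free_group G"
    using h by (auto simp: hom_def free_group_def)
  moreover have "\<forall>x. h (generator x :: 'g letter list) \<one> = f x" by (simp add: h_def generator_def e_def f)
  ultimately show ?thesis by (intro bexI[of _ "\<lambda>w. h w \<one>"])
qed

datatype gen2 = A | B

abbreviation F2 :: "gen2 letter list monoid" where
  "F2 \<equiv> free_group"

abbreviation a :: "gen2 letter list" where
  "a \<equiv> generator A"

abbreviation b :: "gen2 letter list" where
  "b \<equiv> generator B"

abbreviation F2_mult :: "gen2 letter list \<Rightarrow> gen2 letter list \<Rightarrow> gen2 letter list"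
    (infixl \<open>\<cdot>\<close> 70) where
  "x \<cdot> y \<equiv> x \<otimes>\<^bsub>F2\<^esub> y"

abbreviation F2_pow :: "gen2 letter list \<Rightarrow> nat \<Rightarrow> gen2 letter list"
    (infixr \<open>\<up>\<close> 75) where
  "x \<up> n \<equiv> x [^]\<^bsub>F2\<^esub> n"

abbreviation F2_inv :: "gen2 letter list \<Rightarrow> gen2 letter list"
    (\<open>inv\<^sub>F _\<close> [81] 80) where
  "inv\<^sub>F x \<equiv> inv\<^bsub>F2\<^esub> x"

definition primitive :: "gen2 letter list \<Rightarrow> bool" where
  "primitive x \<longleftrightarrow>
    (\<exists>S. S \<subseteq> carrier F2 \<and> card S = 2 \<and> generate F2 S = carrier F2 \<and> x \<in> S)"

definition P :: "nat \<Rightarrow> gen2 letter list set" where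
  "P k = generate F2 {x \<up> k | x. primitive x}"

definition normal_closure :: "('g, 'm) monoid_scheme \<Rightarrow> 'g set \<Rightarrow> 'g set" where
  "normal_closure G S = \<Inter> {N. N \<lhd> G \<and> S \<subseteq> N}"

end

theory Submission
  imports Defs
begin

text \<open>Since a conjugate of a primitive element is primitive, each \<open>P k\<close> is normal, and one inclusion is the
primitivity of the listed words. For the other inclusion, let \<open>N\<close> be normal and contain the listed
powers. Call a pair \<open>(x, y)\<close> in a group good if all listed words, evaluated at \<open>(x, y)\<close>, have trivial
\<open>k\<close>-th power. The images of \<open>(a, b)\<close> in \<open>F2 Mod N\<close> form a good pair, and goodness survives the
elementary Nielsen moves (\<open>slopes2_moves\<close> to \<open>slopes5_moves\<close>) and conjugation. By Nielsen's theorem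
(\<open>generating_imp_basis\<close>) these moves lead from \<open>(a, b)\<close> to every generating pair \<open>(u, v)\<close>. Hence the
image of every such pair is good; the list begins with the word \<open>x\<close>, so \<open>u \<up> k \<in> N\<close>.

Goodness is invariant because the lists hold one word for each slope modulo \<open>k\<close>. A primitive element
is determined up to conjugation by its exponent sums, a primitive integer vector or slope. If \<open>(x, y)\<close>
is a basis and \<open>y\<^sup>k\<close> becomes trivial, then \<open>x\<close> and the primitive element \<open>x y\<^sup>k\<close> have the same image;
this identifies slopes that differ by \<open>k\<close> times a neighbour. For \<open>k \<le> 5\<close> the triangle group
\<open>(2, 3, k)\<close> is finite and equals \<open>PSL(2, \<int>/k)\<close>, which means that \<open>k\<close>-th powers of transvections
generate the level \<open>k\<close> congruence subgroup of \<open>PSL(2, \<int>)\<close>, so that only the slope modulo \<open>k\<close> and up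
to sign survives. There are 3, 4, 6 and 12 such slopes. Concretely, each move sends the list to words
that are brought back to it by explicit rotations, inversions and reductions of exponents modulo \<open>k\<close>.

Nielsen's theorem is proved by induction on the total length of a generating pair. When no move
shortens the pair, its members and their inverses form a Nielsen reduced set, in which products are at
least as long as their factors (\<open>nielsen_reduced_generate\<close>); as the pair generates \<open>a\<close> and \<open>b\<close>, it then consists of
single letters.\<close>

section \<open>Power relations in a group\<close>

context group
begin

lemma conj_hom:
  assumes g: "g \<in> carrier G" shows "(\<lambda>x. g \<otimes> x \<otimes> inv g) \<in> hom G G"
proof (rule homI)
  fix x y assume "x \<in> carrier G" "y \<in> carrier G"
  moreover from this g have "inv g \<otimes> (g \<otimes> (y \<otimes> inv g)) = y \<otimes> inv g"
    by (simp flip: m_assoc)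
  ultimately show "g \<otimes> (x \<otimes> y) \<otimes> inv g = (g \<otimes> x \<otimes> inv g) \<otimes> (g \<otimes> y \<otimes> inv g)"
    using g by (simp add: m_assoc)
qed (use g in simp)

definition tor :: "nat \<Rightarrow> 'a \<Rightarrow> bool" where
  "tor k x \<longleftrightarrow> x \<in> carrier G \<and> x [^] k = \<one>"

lemma tor_inv: "tor k x \<Longrightarrow> tor k (inv x)"
  by (auto simp: tor_def nat_pow_inv)

lemma inv_mult_cancel: "\<lbrakk>x \<in> carrier G; z \<in> carrier G\<rbrakk> \<Longrightarrow> inv x \<otimes> (x \<otimes> z) = z"
  "\<lbrakk>x \<in> carrier G; z \<in> carrier G\<rbrakk> \<Longrightarrow> x \<otimes> (inv x \<otimes> z) = z"
  by (simp_all flip: m_assoc)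

text \<open>Both sides are the alternating word \<open>y x y \<dots> x y\<close>.\<close>

lemma pow_rotate:
  assumes "x \<in> carrier G" "y \<in> carrier G"
  shows "(y \<otimes> x) [^] (k::nat) \<otimes> y = y \<otimes> (x \<otimes> y) [^] k"
proof (induction k)
  case 0
  show ?case using assms by simp
next
  case (Suc k)
  have "(y \<otimes> x) [^] Suc k \<otimes> y = ((y \<otimes> x) [^] k \<otimes> y) \<otimes> (x \<otimes> y)"
    using assms by (simp add: m_assoc)
  also have "\<dots> = (y \<otimes> (x \<otimes> y) [^] k) \<otimes> (x \<otimes> y)" by (simp only: Suc)
  also have "\<dots> = y \<otimes> (x \<otimes> y) [^] Suc k" using assms by (simp add: m_assoc)
  finally show ?case .
qed

lemma tor_cyc:
  assumes "tor k (x \<otimes> y)" "x \<in> carrier G" "y \<in> carrier G" shows "tor k (y \<otimes> x)"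
proof -
  have "(y \<otimes> x) [^] k \<otimes> y = \<one> \<otimes> y"
    using assms pow_rotate[of x y k] by (simp add: tor_def)
  then show ?thesis using assms by (simp add: tor_def del: l_one)
qed

text \<open>Triviality of a power depends only on the cyclic word, up to inversion. The two rules below take the
factorisation \<open>p \<otimes> q\<close> at which the word is cut, and leave word identities that normalisation decides.
A conjugation by \<open>g\<close> is the cut with \<open>p = inv g\<close> and \<open>q = g \<otimes> w\<close>.\<close>

lemma tor_rot:
  "\<lbrakk>tor k w; p \<in> carrier G; q \<in> carrier G; w = p \<otimes> q; z = q \<otimes> p\<rbrakk> \<Longrightarrow> tor k z"
  using tor_cyc[of k p q] by simp

lemma tor_rot_inv:
  "\<lbrakk>tor k w; p \<in> carrier G; q \<in> carrier G; w = p \<otimes> q; z = inv (q \<otimes> p)\<rbrakk> \<Longrightarrow> tor k z"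
  using tor_inv[OF tor_cyc[of k p q]] by simp

lemma pow_words: "x \<in> carrier G \<Longrightarrow> x [^] (2::nat) = x \<otimes> x"
  "x \<in> carrier G \<Longrightarrow> x [^] (3::nat) = x \<otimes> (x \<otimes> x)"
  "x \<in> carrier G \<Longrightarrow> x [^] (4::nat) = x \<otimes> (x \<otimes> (x \<otimes> x))"
  "x \<in> carrier G \<Longrightarrow> x [^] (5::nat) = x \<otimes> (x \<otimes> (x \<otimes> (x \<otimes> x)))"
  by (simp_all add: numeral_eq_Suc m_assoc)

lemmas words = m_assoc inv_mult_group inv_mult_cancel pow_words

lemma tor_carrier: "tor k x \<Longrightarrow> x \<in> carrier G"
  by (simp add: tor_def)

text \<open>Rewrite rules, here and in the three lemmas that follow, that reduce the exponents of \<open>x\<close>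
modulo \<open>k\<close> to representatives of least absolute value in right-associated words. The variants with \<open>z\<close> act in the middle of a word.\<close>

lemma tor2_words:
  assumes "tor 2 x"
  shows "inv x = x" "x \<otimes> x = \<one>" "z \<in> carrier G \<Longrightarrow> x \<otimes> (x \<otimes> z) = z"
proof -
  have x: "x \<in> carrier G" using assms by (simp add: tor_def)
  show "x \<otimes> x = \<one>" using assms x by (simp add: tor_def words)
  then show "inv x = x" using x by (intro inv_equality)
  then show "z \<in> carrier G \<Longrightarrow> x \<otimes> (x \<otimes> z) = z" using inv_mult_cancel[of x z] x by simp
qed

lemma tor3_words:
  assumes "tor 3 x"
  shows "x \<otimes> x = inv x" "inv x \<otimes> inv x = x"
    "z \<in> carrier G \<Longrightarrow> x \<otimes> (x \<otimes> z) = inv x \<otimes> z"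
    "z \<in> carrier G \<Longrightarrow> inv x \<otimes> (inv x \<otimes> z) = x \<otimes> z"
proof -
  have x: "x \<in> carrier G" using assms by (simp add: tor_def)
  show e: "x \<otimes> x = inv x"
    using assms x by (intro inv_equality[symmetric]) (auto simp: tor_def words)
  show f: "inv x \<otimes> inv x = x" using arg_cong[OF e, of "m_inv G"] x by (simp add: words)
  show "z \<in> carrier G \<Longrightarrow> x \<otimes> (x \<otimes> z) = inv x \<otimes> z"
    "z \<in> carrier G \<Longrightarrow> inv x \<otimes> (inv x \<otimes> z) = x \<otimes> z"
    using x by (simp_all add: e f flip: m_assoc)
qed

lemma tor4_words:
  assumes "tor 4 x"
  shows "x \<otimes> (x \<otimes> x) = inv x" "inv x \<otimes> inv x = x \<otimes> x"
    "z \<in> carrier G \<Longrightarrow> x \<otimes> (x \<otimes> (x \<otimes> z)) = inv x \<otimes> z"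
    "z \<in> carrier G \<Longrightarrow> inv x \<otimes> (inv x \<otimes> z) = x \<otimes> (x \<otimes> z)"
proof -
  have x: "x \<in> carrier G" using assms by (simp add: tor_def)
  show e: "x \<otimes> (x \<otimes> x) = inv x"
    using assms x by (intro inv_equality[symmetric]) (auto simp: tor_def words)
  have "inv (x \<otimes> x) = x \<otimes> x" using assms x by (intro inv_equality) (auto simp: tor_def words)
  then show f: "inv x \<otimes> inv x = x \<otimes> x" using x by (simp add: words)
  fix z assume z: "z \<in> carrier G"
  have "x \<otimes> (x \<otimes> (x \<otimes> z)) = (x \<otimes> (x \<otimes> x)) \<otimes> z" using x z by (simp add: m_assoc)
  then show "x \<otimes> (x \<otimes> (x \<otimes> z)) = inv x \<otimes> z" by (simp add: e)
  have "inv x \<otimes> (inv x \<otimes> z) = (inv x \<otimes> inv x) \<otimes> z" using x z by (simp add: m_assoc)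
  then show "inv x \<otimes> (inv x \<otimes> z) = x \<otimes> (x \<otimes> z)" using x z by (simp add: f m_assoc)
qed

lemma tor5_words:
  assumes "tor 5 x"
  shows "x \<otimes> (x \<otimes> x) = inv x \<otimes> inv x" "inv x \<otimes> (inv x \<otimes> inv x) = x \<otimes> x"
    "z \<in> carrier G \<Longrightarrow> x \<otimes> (x \<otimes> (x \<otimes> z)) = inv x \<otimes> (inv x \<otimes> z)"
    "z \<in> carrier G \<Longrightarrow> inv x \<otimes> (inv x \<otimes> (inv x \<otimes> z)) = x \<otimes> (x \<otimes> z)"
proof -
  have x: "x \<in> carrier G" using assms by (simp add: tor_def)
  have "inv (x \<otimes> x) = x \<otimes> (x \<otimes> x)" using assms x by (intro inv_equality) (auto simp: tor_def words)
  then show e: "x \<otimes> (x \<otimes> x) = inv x \<otimes> inv x" using x by (simp add: words)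
  show f: "inv x \<otimes> (inv x \<otimes> inv x) = x \<otimes> x"
    using arg_cong[OF e, of "m_inv G"] x by (simp add: words)
  fix z assume z: "z \<in> carrier G"
  have "x \<otimes> (x \<otimes> (x \<otimes> z)) = (x \<otimes> (x \<otimes> x)) \<otimes> z" using x z by (simp add: m_assoc)
  then show "x \<otimes> (x \<otimes> (x \<otimes> z)) = inv x \<otimes> (inv x \<otimes> z)" using x z by (simp add: e m_assoc)
  have "inv x \<otimes> (inv x \<otimes> (inv x \<otimes> z)) = (inv x \<otimes> (inv x \<otimes> inv x)) \<otimes> z"
    using x z by (simp add: m_assoc)
  then show "inv x \<otimes> (inv x \<otimes> (inv x \<otimes> z)) = x \<otimes> (x \<otimes> z)" using x z by (simp add: f m_assoc)
qed

end

section \<open>One word for each slope modulo k\<close>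

text \<open>Exponent sums of the words below run once through the primitive vectors modulo \<open>k\<close> up to sign. The
definitions are made for an arbitrary group so that the same words can be read in \<open>F2\<close> and in its
quotients.\<close>

definition slopes2 :: "('x, 'm) monoid_scheme \<Rightarrow> 'x \<Rightarrow> 'x \<Rightarrow> 'x set" where
  "slopes2 G x y = {x, y, x \<otimes>\<^bsub>G\<^esub> y}"

definition slopes3 :: "('x, 'm) monoid_scheme \<Rightarrow> 'x \<Rightarrow> 'x \<Rightarrow> 'x set" where
  "slopes3 G x y = {x, y, x \<otimes>\<^bsub>G\<^esub> y, x \<otimes>\<^bsub>G\<^esub> inv\<^bsub>G\<^esub> y}"

definition slopes4 :: "('x, 'm) monoid_scheme \<Rightarrow> 'x \<Rightarrow> 'x \<Rightarrow> 'x set" where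
  "slopes4 G x y = {x, y, x \<otimes>\<^bsub>G\<^esub> y, x \<otimes>\<^bsub>G\<^esub> inv\<^bsub>G\<^esub> y,
     x [^]\<^bsub>G\<^esub> (2::nat) \<otimes>\<^bsub>G\<^esub> y, x \<otimes>\<^bsub>G\<^esub> y [^]\<^bsub>G\<^esub> (2::nat)}"

definition slopes5 :: "('x, 'm) monoid_scheme \<Rightarrow> 'x \<Rightarrow> 'x \<Rightarrow> 'x set" where
  "slopes5 G x y = {x, y, x \<otimes>\<^bsub>G\<^esub> y, x \<otimes>\<^bsub>G\<^esub> inv\<^bsub>G\<^esub> y,
     x [^]\<^bsub>G\<^esub> (2::nat) \<otimes>\<^bsub>G\<^esub> y, x \<otimes>\<^bsub>G\<^esub> y [^]\<^bsub>G\<^esub> (2::nat),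
     x [^]\<^bsub>G\<^esub> (2::nat) \<otimes>\<^bsub>G\<^esub> inv\<^bsub>G\<^esub> y, x \<otimes>\<^bsub>G\<^esub> (inv\<^bsub>G\<^esub> y) [^]\<^bsub>G\<^esub> (2::nat),
     x [^]\<^bsub>G\<^esub> (2::nat) \<otimes>\<^bsub>G\<^esub> y \<otimes>\<^bsub>G\<^esub> x \<otimes>\<^bsub>G\<^esub> y,
     x \<otimes>\<^bsub>G\<^esub> inv\<^bsub>G\<^esub> y \<otimes>\<^bsub>G\<^esub> x \<otimes>\<^bsub>G\<^esub> (inv\<^bsub>G\<^esub> y) [^]\<^bsub>G\<^esub> (2::nat),
     x [^]\<^bsub>G\<^esub> (3::nat) \<otimes>\<^bsub>G\<^esub> y \<otimes>\<^bsub>G\<^esub> x [^]\<^bsub>G\<^esub> (2::nat) \<otimes>\<^bsub>G\<^esub> y,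
     x \<otimes>\<^bsub>G\<^esub> (inv\<^bsub>G\<^esub> y) [^]\<^bsub>G\<^esub> (2::nat) \<otimes>\<^bsub>G\<^esub> x \<otimes>\<^bsub>G\<^esub> (inv\<^bsub>G\<^esub> y) [^]\<^bsub>G\<^esub> (3::nat)}"

context group
begin

text \<open>The automorphism group of \<open>F2\<close> is generated by the exchange of \<open>a\<close> and \<open>b\<close>, the inversion of \<open>b\<close> and
\<open>b \<mapsto> a b\<close>. The lemmas \<open>slopes2_moves\<close> to \<open>slopes5_moves\<close> say that the normal closures in the theorem are characteristic, with
the relations transported to a pair of elements of any group.\<close>

lemma slopes2_moves:
  assumes t: "\<forall>w\<in>slopes2 G x y. tor 2 w"
  shows "\<forall>w\<in>slopes2 G y x. tor 2 w" "\<forall>w\<in>slopes2 G x (inv y). tor 2 w"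
    "\<forall>w\<in>slopes2 G x (x \<otimes> y). tor 2 w"
proof -
  have h: "tor 2 x" "tor 2 y" "tor 2 (x \<otimes> y)" using t by (auto simp: slopes2_def)
  note c = tor_carrier[OF h(1)] tor_carrier[OF h(2)]
  show "\<forall>w\<in>slopes2 G y x. tor 2 w" using h c tor_cyc[OF h(3)] by (auto simp: slopes2_def)
  show "\<forall>w\<in>slopes2 G x (inv y). tor 2 w" using h c
    by (auto simp: slopes2_def tor2_words[OF h(2)])
  show "\<forall>w\<in>slopes2 G x (x \<otimes> y). tor 2 w" using h c
    by (auto simp: slopes2_def tor2_words[OF h(1)])
qed

lemma slopes3_moves:
  assumes t: "\<forall>w\<in>slopes3 G x y. tor 3 w"
  shows "\<forall>w\<in>slopes3 G y x. tor 3 w" "\<forall>w\<in>slopes3 G x (inv y). tor 3 w"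
    "\<forall>w\<in>slopes3 G x (x \<otimes> y). tor 3 w"
proof -
  have h: "tor 3 x" "tor 3 y" "tor 3 (x \<otimes> y)" "tor 3 (x \<otimes> inv y)" using t by (auto simp: slopes3_def)
  have c [simp]: "x \<in> carrier G" "y \<in> carrier G" using h by (simp_all add: tor_carrier)
  note w = words tor3_words[OF h(1)] tor3_words[OF h(2)]
  have "tor 3 (y \<otimes> inv x)" by (rule tor_rot_inv[OF h(4), of \<one> "x \<otimes> inv y"]) (simp_all add: w)
  then show "\<forall>w\<in>slopes3 G y x. tor 3 w" using h tor_cyc[OF h(3)] by (auto simp: slopes3_def)
  show "\<forall>w\<in>slopes3 G x (inv y). tor 3 w" using h tor_inv[OF h(2)] by (auto simp: slopes3_def)
  have "tor 3 (x \<otimes> (x \<otimes> y))" by (rule tor_rot_inv[OF h(4), of x "inv y"]) (simp_all add: w)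
  moreover have "tor 3 (x \<otimes> inv (x \<otimes> y))"
    by (rule tor_rot[OF tor_inv[OF h(2)], of "inv y \<otimes> inv x" x]) (simp_all add: w)
  ultimately show "\<forall>w\<in>slopes3 G x (x \<otimes> y). tor 3 w" using h by (auto simp: slopes3_def)
qed

lemma slopes4_moves:
  assumes t: "\<forall>w\<in>slopes4 G x y. tor 4 w"
  shows "\<forall>w\<in>slopes4 G y x. tor 4 w" "\<forall>w\<in>slopes4 G x (inv y). tor 4 w"
    "\<forall>w\<in>slopes4 G x (x \<otimes> y). tor 4 w"
proof -
  have h: "tor 4 x" "tor 4 y" "tor 4 (x \<otimes> y)" "tor 4 (x \<otimes> inv y)"
    "tor 4 (x [^] (2::nat) \<otimes> y)" "tor 4 (x \<otimes> y [^] (2::nat))"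
    using t by (auto simp: slopes4_def)
  have c [simp]: "x \<in> carrier G" "y \<in> carrier G" using h by (simp_all add: tor_carrier)
  note w = words tor4_words[OF h(1)] tor4_words[OF h(2)]
  have "tor 4 (y \<otimes> inv x)" by (rule tor_rot_inv[OF h(4), of \<one> "x \<otimes> inv y"]) (simp_all add: w)
  then show "\<forall>w\<in>slopes4 G y x. tor 4 w"
    using h tor_cyc[OF h(3)] tor_cyc[OF h(5)] tor_cyc[OF h(6)] by (auto simp: slopes4_def)
  have "tor 4 (x [^] (2::nat) \<otimes> inv y)"
    by (rule tor_rot_inv[OF h(5), of "x [^] (2::nat)" y]) (simp_all add: w)
  moreover have "tor 4 (x \<otimes> inv y [^] (2::nat))" using h(6) by (simp add: w)
  ultimately show "\<forall>w\<in>slopes4 G x (inv y). tor 4 w"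
    using h tor_inv[OF h(2)] by (auto simp: slopes4_def)
  have "tor 4 (x \<otimes> inv (x \<otimes> y))"
    by (rule tor_rot[OF tor_inv[OF h(2)], of "inv y \<otimes> inv x" x]) (simp_all add: w)
  moreover have "tor 4 (x [^] (2::nat) \<otimes> (x \<otimes> y))"
    by (rule tor_rot_inv[OF h(4), of x "inv y"]) (simp_all add: w)
  moreover have "tor 4 (x \<otimes> (x \<otimes> y) [^] (2::nat))"
  proof (rule tor_rot_inv[OF h(6), of "inv (x \<otimes> y)" "x \<otimes> y \<otimes> (x \<otimes> (y \<otimes> y))"])
    \<comment> \<open>Slope \<open>(3, 2)\<close> is congruent to \<open>(- 1, - 2)\<close>; the fourth power of \<open>x y\<close> connects the two.\<close>
    have "x \<otimes> (x \<otimes> y) [^] (2::nat) = x \<otimes> inv (x \<otimes> y) [^] (2::nat)"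
      using tor4_words(2)[OF h(3)] by (simp add: pow_words)
    then show "x \<otimes> (x \<otimes> y) [^] (2::nat) = inv (x \<otimes> y \<otimes> (x \<otimes> (y \<otimes> y)) \<otimes> inv (x \<otimes> y))" by (simp add: w)
  qed (simp_all add: w)
  moreover have "tor 4 (x \<otimes> (x \<otimes> y))" using h(5) by (simp add: w)
  ultimately show "\<forall>w\<in>slopes4 G x (x \<otimes> y). tor 4 w" using h by (auto simp: slopes4_def)
qed

text \<open>The slopes \<open>(3, 2)\<close> and \<open>(2, 3)\<close> agree modulo 5 up to sign: \<open>(3, 2) + (2, 3) = 5 (1, 1)\<close>. Accordingly
one word is carried to the other by the fifth power of \<open>x y\<close>.\<close>

lemma tor5_slide:
  assumes "tor 5 (x \<otimes> y)" and t: "tor 5 (x \<otimes> (y \<otimes> (x \<otimes> (y \<otimes> y))))"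
    and c [simp]: "x \<in> carrier G" "y \<in> carrier G"
  shows "tor 5 (x \<otimes> (x \<otimes> (y \<otimes> (x \<otimes> y))))"
proof -
  \<comment> \<open>Replacing \<open>(x y)\<^sup>2\<close> by \<open>(x y)\<^sup>-\<^sup>3\<close> in \<open>x (x y)\<^sup>2\<close> leaves a conjugate of the inverse of \<open>y x y x y\<close>.\<close>
  have "(x \<otimes> y) \<otimes> (x \<otimes> y) = inv (x \<otimes> y) \<otimes> (inv (x \<otimes> y) \<otimes> inv (x \<otimes> y))"
    using tor5_words(2)[OF assms(1)] by simp
  then have "x \<otimes> (x \<otimes> (y \<otimes> (x \<otimes> y)))
      = x \<otimes> (inv y \<otimes> inv x) \<otimes> ((inv y \<otimes> inv x) \<otimes> (inv y \<otimes> inv x))"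
    by (simp add: words)
  then have eq: "x \<otimes> (x \<otimes> (y \<otimes> (x \<otimes> y)))
      = inv (x \<otimes> (y \<otimes> (x \<otimes> (y \<otimes> (x \<otimes> y)))) \<otimes> inv x)"
    by (simp add: words)
  have yxyxy: "tor 5 (y \<otimes> (x \<otimes> (y \<otimes> (x \<otimes> y))))"
    by (rule tor_rot[OF t, of "x \<otimes> (y \<otimes> (x \<otimes> y))" y]) (simp_all add: words)
  show ?thesis
    by (rule tor_rot_inv[OF yxyxy, of "inv x" "x \<otimes> (y \<otimes> (x \<otimes> (y \<otimes> (x \<otimes> y))))"])
      (simp_all only: eq, simp_all add: words)
qed

lemma slopes5_moves:
  assumes t: "\<forall>w\<in>slopes5 G x y. tor 5 w"
  shows "\<forall>w\<in>slopes5 G y x. tor 5 w" "\<forall>w\<in>slopes5 G x (inv y). tor 5 w"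
    "\<forall>w\<in>slopes5 G x (x \<otimes> y). tor 5 w"
proof -
  have h: "tor 5 x" "tor 5 y" "tor 5 (x \<otimes> y)" "tor 5 (x \<otimes> inv y)"
    "tor 5 (x [^] (2::nat) \<otimes> y)" "tor 5 (x \<otimes> y [^] (2::nat))"
    "tor 5 (x [^] (2::nat) \<otimes> inv y)" "tor 5 (x \<otimes> inv y [^] (2::nat))"
    "tor 5 (x [^] (2::nat) \<otimes> y \<otimes> x \<otimes> y)" "tor 5 (x \<otimes> inv y \<otimes> x \<otimes> inv y [^] (2::nat))"
    "tor 5 (x [^] (3::nat) \<otimes> y \<otimes> x [^] (2::nat) \<otimes> y)"
    "tor 5 (x \<otimes> inv y [^] (2::nat) \<otimes> x \<otimes> inv y [^] (3::nat))"
    using t by (auto simp: slopes5_def)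
  have c [simp]: "x \<in> carrier G" "y \<in> carrier G" using h by (simp_all add: tor_carrier)
  note w = words tor5_words[OF h(1)] tor5_words[OF h(2)]
  let ?X = "inv x" and ?Y = "inv y"
  \<comment> \<open>The slopes \<open>(2, 3)\<close> and \<open>(3, - 2)\<close>, obtained next, represent the same classes as \<open>(3, 2)\<close> and
    \<open>(2, - 3)\<close> on the list.\<close>
  have yxyxx: "tor 5 (y \<otimes> (x \<otimes> (y \<otimes> (x \<otimes> x))))"
    by (rule tor_rot[OF h(9), of "x \<otimes> x" "y \<otimes> (x \<otimes> y)"]) (simp_all add: w)
  have yyxyx: "tor 5 (y \<otimes> (y \<otimes> (x \<otimes> (y \<otimes> x))))"
    by (rule tor5_slide[OF tor_cyc[OF h(3)] yxyxx]) simp_all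
  have xxYxY: "tor 5 (x \<otimes> (x \<otimes> (?Y \<otimes> (x \<otimes> ?Y))))"
    using h(10) by (intro tor5_slide[OF h(4)]) (simp_all add: words)
  show "\<forall>w\<in>slopes5 G y x. tor 5 w"
  proof -
    have "tor 5 (y \<otimes> ?X)"
      by (rule tor_rot_inv[OF h(4), of \<one> "x \<otimes> ?Y"]) (simp_all add: w)
    moreover have "tor 5 (y [^] (2::nat) \<otimes> ?X)"
      by (rule tor_rot_inv[OF h(8), of \<one> "x \<otimes> ?Y [^] (2::nat)"]) (simp_all add: w)
    moreover have "tor 5 (y \<otimes> ?X [^] (2::nat))"
      by (rule tor_rot_inv[OF h(7), of \<one> "x [^] (2::nat) \<otimes> ?Y"]) (simp_all add: w)
    moreover have "tor 5 (y [^] (2::nat) \<otimes> x \<otimes> y \<otimes> x)"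
      using yyxyx by (simp add: words)
    moreover have "tor 5 (y \<otimes> ?X \<otimes> y \<otimes> ?X [^] (2::nat))"
      using tor_inv[OF xxYxY] by (simp add: words)
    moreover have "tor 5 (y [^] (3::nat) \<otimes> x \<otimes> y [^] (2::nat) \<otimes> x)"
      by (rule tor_rot[OF h(12), of x "?Y \<otimes> (?Y \<otimes> (x \<otimes> (?Y \<otimes> (?Y \<otimes> ?Y))))"]) (simp_all add: w)
    moreover have "tor 5 (y \<otimes> ?X [^] (2::nat) \<otimes> y \<otimes> ?X [^] (3::nat))"
      by (rule tor_rot[OF h(11), of "x \<otimes> (x \<otimes> (x \<otimes> (y \<otimes> (x \<otimes> x))))" y]) (simp_all add: w)
    ultimately show ?thesis
      using h tor_cyc[OF h(3)] tor_cyc[OF h(5)] tor_cyc[OF h(6)] by (auto simp: slopes5_def)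
  qed
  show "\<forall>w\<in>slopes5 G x (inv y). tor 5 w"
  proof -
    have "tor 5 (x [^] (2::nat) \<otimes> ?Y \<otimes> x \<otimes> ?Y)"
      using xxYxY by (simp add: words)
    moreover have "tor 5 (x \<otimes> y \<otimes> x \<otimes> y [^] (2::nat))"
      by (rule tor_rot[OF yyxyx, of "y \<otimes> y" "x \<otimes> (y \<otimes> x)"]) (simp_all add: w)
    moreover have "tor 5 (x [^] (3::nat) \<otimes> ?Y \<otimes> x [^] (2::nat) \<otimes> ?Y)"
      by (rule tor_rot_inv[OF h(11), of "x \<otimes> (x \<otimes> (x \<otimes> (y \<otimes> (x \<otimes> x))))" y]) (simp_all add: w)
    moreover have "tor 5 (x \<otimes> y [^] (2::nat) \<otimes> x \<otimes> y [^] (3::nat))"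
      by (rule tor_rot[OF h(12), of "x \<otimes> (?Y \<otimes> ?Y)" "x \<otimes> (?Y \<otimes> (?Y \<otimes> ?Y))"]) (simp_all add: w)
    ultimately show ?thesis
      using h tor_inv[OF h(2)] by (auto simp: slopes5_def)
  qed
  show "\<forall>w\<in>slopes5 G x (x \<otimes> y). tor 5 w"
  proof -
    let ?z = "x \<otimes> y"
    have "tor 5 (x \<otimes> ?z)" using h(5) by (simp add: words)
    moreover have "tor 5 (x \<otimes> inv ?z)"
      by (rule tor_rot[OF tor_inv[OF h(2)], of "?Y \<otimes> ?X" x]) (simp_all add: w)
    moreover have "tor 5 (x [^] (2::nat) \<otimes> ?z)"
      by (rule tor_rot_inv[OF h(7), of "x \<otimes> x" ?Y]) (simp_all add: w)
    moreover have "tor 5 (x \<otimes> ?z [^] (2::nat))" using h(9) by (simp add: words)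
    moreover have "tor 5 (x [^] (2::nat) \<otimes> inv ?z)"
      by (rule tor_rot[OF h(4), of "x \<otimes> (?Y \<otimes> ?X)" x]) (simp_all add: w)
    moreover have "tor 5 (x \<otimes> inv ?z [^] (2::nat))"
      by (rule tor_rot_inv[OF h(6), of "inv ?z" "?z \<otimes> (x \<otimes> (y \<otimes> y))"]) (simp_all add: w)
    moreover have "tor 5 (x [^] (2::nat) \<otimes> ?z \<otimes> x \<otimes> ?z)" using h(11) by (simp add: words)
    moreover have "tor 5 (x \<otimes> inv ?z \<otimes> x \<otimes> inv ?z [^] (2::nat))"
      by (rule tor_rot_inv[OF h(8), of "inv ?z" "?z \<otimes> (x \<otimes> (?Y \<otimes> ?Y))"]) (simp_all add: w)
    moreover have "tor 5 (x [^] (3::nat) \<otimes> ?z \<otimes> x [^] (2::nat) \<otimes> ?z)"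
      by (rule tor_rot_inv[OF xxYxY, of "x \<otimes> (x \<otimes> (?Y \<otimes> x))" ?Y]) (simp_all add: w)
    moreover have "tor 5 (x \<otimes> inv ?z [^] (2::nat) \<otimes> x \<otimes> inv ?z [^] (3::nat))"
    proof -
      \<comment> \<open>The inverse of the word in question is a conjugate of \<open>x y v\<^sup>2\<close>, of slope \<open>(3, 5)\<close>. Subtracting
        five times the slope \<open>(1, 2)\<close> of \<open>v\<close> gives \<open>(- 2, - 5)\<close>, the negative of the slope of
        \<open>x y\<^sup>2 x y\<^sup>3\<close>, which is \<open>x y\<^sup>-\<^sup>3 x y\<^sup>-\<^sup>2\<close> modulo fifth powers.\<close>
      let ?v = "x \<otimes> (y \<otimes> y)"
      have v: "tor 5 ?v" using h(6) by (simp add: words)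
      have "tor 5 (y \<otimes> (y \<otimes> (x \<otimes> (y \<otimes> (y \<otimes> (x \<otimes> y))))))"
        by (rule tor_rot[OF h(12), of "x \<otimes> y" "y \<otimes> (y \<otimes> (x \<otimes> (y \<otimes> y)))"]) (simp_all add: w)
      then have "tor 5 (x \<otimes> y \<otimes> (inv ?v \<otimes> (inv ?v \<otimes> inv ?v)))"
        by (rule tor_rot_inv[of _ _ "?X" "x \<otimes> (y \<otimes> (y \<otimes> (x \<otimes> (y \<otimes> (y \<otimes> (x \<otimes> y))))))"])
          (simp_all add: words)
      then have "tor 5 (x \<otimes> y \<otimes> (?v \<otimes> ?v))" using tor5_words(2)[OF v] by simp
      then show ?thesis
        by (rule tor_rot_inv[of _ _ "inv ?z" "?z \<otimes> (x \<otimes> y \<otimes> (?v \<otimes> ?v))"])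
          (simp_all add: words)
    qed
    ultimately show ?thesis using h by (auto simp: slopes5_def)
  qed
qed

end

lemma slopes_hom:
  assumes "group_hom G H h" "x \<in> carrier G" "y \<in> carrier G"
  shows "slopes2 H (h x) (h y) = h ` slopes2 G x y" "slopes3 H (h x) (h y) = h ` slopes3 G x y"
    "slopes4 H (h x) (h y) = h ` slopes4 G x y" "slopes5 H (h x) (h y) = h ` slopes5 G x y"
proof -
  interpret group_hom G H h by fact
  show "slopes2 H (h x) (h y) = h ` slopes2 G x y" "slopes3 H (h x) (h y) = h ` slopes3 G x y"
    "slopes4 H (h x) (h y) = h ` slopes4 G x y" "slopes5 H (h x) (h y) = h ` slopes5 G x y"
    using assms by (simp_all add: slopes2_def slopes3_def slopes4_def slopes5_def hom_nat_pow)
qed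

section \<open>Cancellation in free groups\<close>

interpretation free: group free_group
  by (rule group_free_group)

abbreviation flip :: "'g letter list \<Rightarrow> 'g letter list" where
  "flip w \<equiv> map inv_letter (rev w)"

lemma reduced_iff_successively: "reduced w \<longleftrightarrow> successively (\<lambda>l m. m \<noteq> inv_letter l) w"
  by (induction w rule: reduced.induct) auto

lemma inv_letter_eq_iff: "inv_letter l = m \<longleftrightarrow> l = inv_letter m"
  by auto

lemma reduced_flip: "reduced w \<Longrightarrow> reduced (flip w)"
  unfolding reduced_iff_successively successively_map successively_rev
  by (rule successively_mono) (auto simp: eq_commute)

lemma mult_eq_append: "reduced (u @ v) \<Longrightarrow> u \<otimes>\<^bsub>free_group\<^esub> v = u @ v"
proof (induction u)
  case (Cons l u)
  then have "reduced (u @ v)" by (auto dest: reduced_tl)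
  with Cons show ?case by (simp add: free_group_def push_reduced)
qed (simp add: free_group_def)

lemma carrier_iff: "w \<in> carrier free_group \<longleftrightarrow> reduced w"
  by (simp add: free_group_def)

lemma inv_eq_flip:
  assumes "w \<in> carrier free_group" shows "inv\<^bsub>free_group\<^esub> w = flip w"
proof (rule free.inv_equality)
  show "flip w \<otimes>\<^bsub>free_group\<^esub> w = \<one>\<^bsub>free_group\<^esub>"
    using assms foldr_push_rev_inv[of "[]" w] by (simp add: free_group_def foldr_push_Nil)
qed (use assms in \<open>auto simp: carrier_iff reduced_flip\<close>)

lemma length_inv: "w \<in> carrier free_group \<Longrightarrow> length (inv\<^bsub>free_group\<^esub> w) = length w"
  by (simp add: inv_eq_flip)

text \<open>The length of the longest common prefix of two reduced words, that is, their Gromov product in the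
Cayley tree. Cancellation in a product \<open>x y\<close> is measured by \<open>lcp\<close> of \<open>inv x\<close> and \<open>y\<close>; the arguments
below rest on \<open>length_mult\<close>, the tree inequality \<open>lcp_ultrametric\<close> and \<open>lcp_inv_self_less\<close>.\<close>

fun lcp :: "'a list \<Rightarrow> 'a list \<Rightarrow> nat" where
  "lcp (k # x) (l # y) = (if k = l then Suc (lcp x y) else 0)"
| "lcp _ _ = 0"

lemma lcp_commute: "lcp x y = lcp y x"
  by (induction x y rule: lcp.induct) auto

lemma lcp_self [simp]: "lcp x x = length x"
  by (induction x) auto

lemma lcp_ultrametric: "min (lcp x z) (lcp z y) \<le> lcp x y"
proof (induction x y arbitrary: z rule: lcp.induct)
  case (1 k x l y)
  then show ?case by (cases z) auto
qed auto

lemma take_lcp: "n \<le> lcp x y \<Longrightarrow> take n x = take n y"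
proof (induction x y arbitrary: n rule: lcp.induct)
  case (1 k x l y)
  then show ?case by (cases n) (auto split: if_splits)
qed auto

lemma length_flip_push:
  "\<lbrakk>reduced x; reduced y\<rbrakk> \<Longrightarrow> length (foldr push (flip x) y) + 2 * lcp x y = length x + length y"
proof (induction x y rule: lcp.induct)
  case (1 k x l y)
  show ?case
  proof (cases "k = l")
    case True
    with 1 have "length (foldr push (flip x) y) + 2 * lcp x y = length x + length y"
      by (auto dest: reduced_tl)
    with True show ?thesis by simp
  next
    case False
    have "reduced (flip (k # x) @ (l # y))"
      using reduced_flip[OF 1(2)] 1(3) False
      by (auto simp: reduced_iff_successively successively_append_iff inv_letter_eq_iff)
    from mult_eq_append[OF this] False show ?thesis by (simp add: free_group_def)
  qed
next
  case ("2_2" x)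
  then show ?case using foldr_push_Nil[OF reduced_flip[OF "2_2"(1)]] by simp
qed auto

lemma length_inv_mult:
  assumes "x \<in> carrier free_group" "y \<in> carrier free_group"
  shows "length (inv\<^bsub>free_group\<^esub> x \<otimes>\<^bsub>free_group\<^esub> y) + 2 * lcp x y = length x + length y"
  using assms length_flip_push[of x y] by (simp add: inv_eq_flip) (simp add: free_group_def)

lemma length_mult:
  assumes "x \<in> carrier free_group" "y \<in> carrier free_group"
  shows "length (x \<otimes>\<^bsub>free_group\<^esub> y) + 2 * lcp (inv\<^bsub>free_group\<^esub> x) y = length x + length y"
  using length_inv_mult[of "inv\<^bsub>free_group\<^esub> x" y] assms by (simp add: length_inv)

text \<open>If half of \<open>x\<close> cancelled in \<open>x x\<close>, then the middle letter of \<open>x\<close> would be its own inverse, or the two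
middle letters would be inverse to each other. The first is absurd, the second contradicts that \<open>x\<close>
is reduced.\<close>

lemma lcp_inv_self_less:
  assumes x: "x \<in> carrier free_group" and "x \<noteq> []"
  shows "2 * lcp (inv\<^bsub>free_group\<^esub> x) x < length x"
proof (rule ccontr)
  assume not: "\<not> ?thesis"
  define n where "n = length x"
  define i where "i = (n - 1) div 2"
  have n: "0 < n" using \<open>x \<noteq> []\<close> by (simp add: n_def)
  have "take (lcp (flip x) x) (flip x) = take (lcp (flip x) x) x" by (rule take_lcp) simp
  moreover have "i < n" using n by (simp add: i_def)
  moreover have "i < lcp (flip x) x"
    using not n unfolding i_def n_def inv_eq_flip[OF x] by linarith
  ultimately have "flip x ! i = x ! i" by (metis nth_take)
  then have eq: "inv_letter (x ! (n - 1 - i)) = x ! i"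
    using \<open>i < n\<close> by (simp add: n_def rev_nth)
  show False
  proof (cases "even n")
    case True
    then obtain m where "n = 2 * Suc m" using n by (metis evenE gr0_conv_Suc mult_eq_0_iff not_gr0)
    then have j: "n - 1 - i = Suc i" "Suc i < n" by (simp_all add: i_def)
    have "x ! Suc i \<noteq> inv_letter (x ! i)"
      using x j(2) by (auto simp: carrier_iff reduced_iff_successively successively_conv_nth n_def)
    with eq j(1) show False by (metis inv_letter_invol)
  next
    case False
    then have "n - 1 - i = i" by (elim oddE; simp add: i_def)
    with eq show False by (metis inv_letter_def snd_conv)
  qed
qed

section \<open>Nielsen reduced sets\<close>

text \<open>\<open>red_prod X g x\<close>: the element \<open>g\<close> is a product of members of \<open>X\<close> without adjacent inverse factors,
and \<open>x\<close> is the last factor.\<close>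

inductive red_prod :: "'g letter list set \<Rightarrow> 'g letter list \<Rightarrow> 'g letter list \<Rightarrow> bool"
  for X where
  single: "x \<in> X \<Longrightarrow> red_prod X x x"
| snoc: "\<lbrakk>red_prod X g x; y \<in> X; y \<noteq> inv\<^bsub>free_group\<^esub> x\<rbrakk>
    \<Longrightarrow> red_prod X (g \<otimes>\<^bsub>free_group\<^esub> y) y"

lemma red_prod_carrier:
  assumes "red_prod X g x" "X \<subseteq> carrier free_group"
  shows "g \<in> carrier free_group" "x \<in> X" "x \<in> carrier free_group"
  using assms by (induction rule: red_prod.induct) auto

lemma red_prod_mult:
  assumes X: "X \<subseteq> carrier free_group"
    and g: "g = \<one>\<^bsub>free_group\<^esub> \<or> (\<exists>x. red_prod X g x)" and y: "y \<in> X"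
  shows "g \<otimes>\<^bsub>free_group\<^esub> y = \<one>\<^bsub>free_group\<^esub> \<or> (\<exists>x. red_prod X (g \<otimes>\<^bsub>free_group\<^esub> y) x)"
proof (cases "g = \<one>\<^bsub>free_group\<^esub>")
  case True
  with y X show ?thesis by (auto simp: subset_eq intro: red_prod.single)
next
  case False
  with g obtain x where x: "red_prod X g x" by blast
  show ?thesis
  proof (cases "y = inv\<^bsub>free_group\<^esub> x")
    case True
    from x show ?thesis
    proof cases
      case single
      with True X show ?thesis by auto
    next
      case (snoc g' x')
      then have "g \<otimes>\<^bsub>free_group\<^esub> y = g'"
        using True X red_prod_carrier[OF snoc(2) X] by (auto simp: free.m_assoc)
      with snoc(2) show ?thesis by metis
    qed
  next
    case False
    with x y show ?thesis by (auto intro: red_prod.snoc)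
  qed
qed

lemma generate_red_prod:
  assumes X: "X \<subseteq> carrier free_group" and X_inv: "\<And>x. x \<in> X \<Longrightarrow> inv\<^bsub>free_group\<^esub> x \<in> X"
    and h: "h \<in> generate free_group X"
  shows "h = \<one>\<^bsub>free_group\<^esub> \<or> (\<exists>x. red_prod X h x)"
proof -
  let ?M = "{g. g \<in> carrier free_group \<and> (g = \<one>\<^bsub>free_group\<^esub> \<or> (\<exists>x. red_prod X g x))}"
  have "\<forall>g\<in>?M. g \<otimes>\<^bsub>free_group\<^esub> h \<in> ?M"
    using h
  proof (induction)
    case (incl h)
    then show ?case using red_prod_mult[OF X] X by auto
  next
    case (inv h)
    then show ?case using red_prod_mult[OF X] X X_inv by auto
  next
    case (eng h1 h2)
    then show ?case using free.generate_in_carrier[OF X] by (auto simp flip: free.m_assoc)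
  qed auto
  then have "\<one>\<^bsub>free_group\<^esub> \<otimes>\<^bsub>free_group\<^esub> h \<in> ?M" by blast
  then show ?thesis using free.generate_in_carrier[OF X h] by simp
qed

text \<open>In a product \<open>g\<close> without adjacent inverse factors, the condition \<open>core\<close> keeps a piece of the last
factor \<open>x\<close> from being consumed from both sides. So \<open>g\<close> still ends in a part of \<open>x\<close> longer than what
the next factor \<open>y\<close> can cancel, and \<open>y\<close> cancels against \<open>g\<close> exactly as much as against \<open>x\<close>. By \<open>half\<close>
the length cannot drop, and it dominates the length of every factor used.\<close>

lemma nielsen_reduced_generate:
  fixes X :: "'g letter list set"
  assumes X: "X \<subseteq> carrier free_group" and one: "\<one>\<^bsub>free_group\<^esub> \<notin> X"
    and X_inv: "\<And>x. x \<in> X \<Longrightarrow> inv\<^bsub>free_group\<^esub> x \<in> X"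
    and half: "\<And>x y. \<lbrakk>x \<in> X; y \<in> X; y \<noteq> inv\<^bsub>free_group\<^esub> x\<rbrakk>
      \<Longrightarrow> 2 * lcp (inv\<^bsub>free_group\<^esub> x) y \<le> length x \<and> 2 * lcp (inv\<^bsub>free_group\<^esub> x) y \<le> length y"
    and core: "\<And>w x y. \<lbrakk>w \<in> X; x \<in> X; y \<in> X; x \<noteq> inv\<^bsub>free_group\<^esub> w; y \<noteq> inv\<^bsub>free_group\<^esub> x\<rbrakk>
      \<Longrightarrow> lcp (inv\<^bsub>free_group\<^esub> w) x + lcp (inv\<^bsub>free_group\<^esub> x) y < length x"
    and g: "g \<in> generate free_group X"
  shows "g \<in> generate free_group {x \<in> X. length x \<le> length g}"
proof -
  have pos: "0 < length x" if "x \<in> X" for x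
    using that one by (auto simp: free_group_def)
  have *: "length x \<le> length g \<and> g \<in> generate free_group {x \<in> X. length x \<le> length g} \<and>
      (\<forall>y\<in>X. y \<noteq> inv\<^bsub>free_group\<^esub> x \<longrightarrow>
        lcp (inv\<^bsub>free_group\<^esub> x) y < lcp (inv\<^bsub>free_group\<^esub> g) (inv\<^bsub>free_group\<^esub> x))"
    if "red_prod X g x" for g x
    using that
  proof (induction)
    case (single x)
    have "lcp (inv\<^bsub>free_group\<^esub> x) y < length x" if "y \<in> X" "y \<noteq> inv\<^bsub>free_group\<^esub> x" for y
      using half[OF single that] pos[OF single] by linarith
    moreover have "length (inv\<^bsub>free_group\<^esub> x) = length x" using single X by (auto simp: length_inv)
    ultimately show ?case using single by (auto intro: generate.incl)
  next
    case (snoc g x y)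
    note c = red_prod_carrier[OF snoc(1) X]
    have yc: "y \<in> carrier free_group" using snoc X by blast
    have lt: "lcp (inv\<^bsub>free_group\<^esub> x) y < lcp (inv\<^bsub>free_group\<^esub> g) (inv\<^bsub>free_group\<^esub> x)"
      using snoc by blast
    \<comment> \<open>The smaller two of three pairwise common prefixes have equal length.\<close>
    then have eq: "lcp (inv\<^bsub>free_group\<^esub> g) y = lcp (inv\<^bsub>free_group\<^esub> x) y"
      using lcp_ultrametric[of "inv\<^bsub>free_group\<^esub> g" "inv\<^bsub>free_group\<^esub> x" y]
        lcp_ultrametric[of "inv\<^bsub>free_group\<^esub> x" "inv\<^bsub>free_group\<^esub> g" y]
        lcp_commute[of "inv\<^bsub>free_group\<^esub> x" "inv\<^bsub>free_group\<^esub> g"]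
      by linarith
    have len: "length (g \<otimes>\<^bsub>free_group\<^esub> y) + 2 * lcp (inv\<^bsub>free_group\<^esub> x) y = length g + length y"
      using length_mult[OF c(1) yc] eq by simp
    have h: "2 * lcp (inv\<^bsub>free_group\<^esub> x) y \<le> length x" "2 * lcp (inv\<^bsub>free_group\<^esub> x) y \<le> length y"
      using half[OF c(2) snoc(2,3)] by auto
    have le: "length g \<le> length (g \<otimes>\<^bsub>free_group\<^esub> y)" "length y \<le> length (g \<otimes>\<^bsub>free_group\<^esub> y)"
      using len h snoc.IH by linarith+
    have "g \<otimes>\<^bsub>free_group\<^esub> y \<in> generate free_group {x \<in> X. length x \<le> length (g \<otimes>\<^bsub>free_group\<^esub> y)}"
    proof (rule generate.eng)
      have "{x \<in> X. length x \<le> length g} \<subseteq> {x \<in> X. length x \<le> length (g \<otimes>\<^bsub>free_group\<^esub> y)}"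
        using le(1) by auto
      then show "g \<in> generate free_group {x \<in> X. length x \<le> length (g \<otimes>\<^bsub>free_group\<^esub> y)}"
        using snoc.IH free.mono_generate by blast
    qed (use le(2) snoc(2) in \<open>auto intro: generate.incl\<close>)
    moreover have "lcp (inv\<^bsub>free_group\<^esub> y) z
        < lcp (inv\<^bsub>free_group\<^esub> (g \<otimes>\<^bsub>free_group\<^esub> y)) (inv\<^bsub>free_group\<^esub> y)"
      if "z \<in> X" "z \<noteq> inv\<^bsub>free_group\<^esub> y" for z
    proof -
      have "g \<otimes>\<^bsub>free_group\<^esub> y \<otimes>\<^bsub>free_group\<^esub> inv\<^bsub>free_group\<^esub> y = g"
        using c yc by (simp add: free.m_assoc)
      then have "length g + 2 * lcp (inv\<^bsub>free_group\<^esub> (g \<otimes>\<^bsub>free_group\<^esub> y)) (inv\<^bsub>free_group\<^esub> y)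
          = length (g \<otimes>\<^bsub>free_group\<^esub> y) + length y"
        using length_mult[of "g \<otimes>\<^bsub>free_group\<^esub> y" "inv\<^bsub>free_group\<^esub> y"] c yc by (simp add: length_inv)
      then show ?thesis using len core[OF c(2) snoc(2) that(1) snoc(3) that(2)] by linarith
    qed
    ultimately show ?case using le by blast
  qed
  from generate_red_prod[OF X X_inv g] show ?thesis
    using * by (auto intro: generate.one)
qed

section \<open>Generating pairs of the free group of rank two\<close>

text \<open>Inner automorphisms are products of the other moves. Having them as a move makes it possible to shorten a
pair by conjugation in \<open>generating_imp_basis\<close>, and gives at once that conjugates of primitive elements
are primitive.\<close>

inductive basis :: "gen2 letter list \<Rightarrow> gen2 letter list \<Rightarrow> bool" where
  generators: "basis a b"
| swap: "basis u v \<Longrightarrow> basis v u"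
| inv: "basis u v \<Longrightarrow> basis u (inv\<^sub>F v)"
| mult: "basis u v \<Longrightarrow> basis u (u \<cdot> v)"
| conj: "\<lbrakk>basis u v; g \<in> carrier F2\<rbrakk> \<Longrightarrow> basis (g \<cdot> u \<cdot> inv\<^sub>F g) (g \<cdot> v \<cdot> inv\<^sub>F g)"

lemma basis_carrier:
  assumes "basis u v" shows "u \<in> carrier F2" "v \<in> carrier F2"
  using assms by (induction) (auto simp: generator_closed)

lemma basis_inv_left: "basis u v \<Longrightarrow> basis (inv\<^sub>F u) v"
  by (rule basis.swap[OF basis.inv[OF basis.swap]])

lemma basis_inv_iff:
  assumes "u \<in> carrier F2" "v \<in> carrier F2"
  shows "basis (inv\<^sub>F u) v \<longleftrightarrow> basis u v" "basis u (inv\<^sub>F v) \<longleftrightarrow> basis u v"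
  using assms basis_inv_left basis.inv by (metis free.inv_inv)+

lemma basis_mult_cancel:
  assumes "basis u (u \<cdot> v)" "u \<in> carrier F2" "v \<in> carrier F2" shows "basis u v"
proof -
  have "inv\<^sub>F u \<cdot> (u \<cdot> v) = v" using assms by (simp flip: free.m_assoc)
  then have "basis (inv\<^sub>F u) v"
    using basis.mult[OF basis_inv_left[OF assms(1)]] by simp
  then show ?thesis using assms by (simp add: basis_inv_iff)
qed

lemma basis_mult_right_cancel:
  assumes "basis u (v \<cdot> u)" "u \<in> carrier F2" "v \<in> carrier F2" shows "basis u v"
proof -
  have "basis (inv\<^sub>F u) (inv\<^sub>F u \<cdot> inv\<^sub>F v)"
    using basis_inv_left[OF basis.inv[OF assms(1)]] assms(2,3) by (simp add: free.inv_mult_group)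
  then have "basis (inv\<^sub>F u) (inv\<^sub>F v)" by (rule basis_mult_cancel) (use assms in auto)
  then show ?thesis using assms by (simp add: basis_inv_iff)
qed

lemma basis_conj_cancel:
  assumes "basis (inv\<^sub>F g \<cdot> u \<cdot> g) (inv\<^sub>F g \<cdot> v \<cdot> g)"
    and c: "u \<in> carrier F2" "v \<in> carrier F2" "g \<in> carrier F2"
  shows "basis u v"
proof -
  have "g \<cdot> (inv\<^sub>F g \<cdot> w \<cdot> g) \<cdot> inv\<^sub>F g = w" if "w \<in> carrier F2" for w
    using that c by (simp add: free.m_assoc) (simp flip: free.m_assoc)
  then show ?thesis using basis.conj[OF assms(1), of g] c by simp
qed

definition generating :: "gen2 letter list \<Rightarrow> gen2 letter list \<Rightarrow> bool" where
  "generating u v \<longleftrightarrow> u \<in> carrier F2 \<and> v \<in> carrier F2 \<and> generate F2 {u, v} = carrier F2"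

lemma generating_trans:
  assumes "generating u v" "u' \<in> carrier F2" "v' \<in> carrier F2"
    "u \<in> generate F2 {u', v'}" "v \<in> generate F2 {u', v'}"
  shows "generating u' v'"
proof -
  have sub: "subgroup (generate F2 {u', v'}) F2"
    using assms by (intro free.generate_is_subgroup) auto
  have "generate F2 {u, v} \<subseteq> generate F2 {u', v'}"
    using assms sub by (intro free.generate_subgroup_incl) auto
  then show ?thesis using assms sub by (auto simp: generating_def dest: subgroup.mem_carrier)
qed

lemma generating_generators: "generating a b"
proof -
  have "(UNIV :: gen2 set) = {A, B}" using gen2.exhaust by auto
  then have "range generator = {a, b}" by (metis image_insert image_empty)
  then show ?thesis using generate_generators[where 'a = gen2] by (simp add: generating_def generator_closed)
qed

lemma generating_swap: "generating u v \<Longrightarrow> generating v u"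
  by (simp add: generating_def insert_commute)

lemma generating_inv:
  assumes "generating u v" shows "generating u (inv\<^sub>F v)"
proof (rule generating_trans[OF assms])
  show "v \<in> generate F2 {u, inv\<^sub>F v}"
    using generate.inv[of "inv\<^sub>F v" "{u, inv\<^sub>F v}" F2] assms by (simp add: generating_def)
qed (use assms in \<open>auto simp: generating_def intro: generate.incl\<close>)

lemma generating_inv_left: "generating u v \<Longrightarrow> generating (inv\<^sub>F u) v"
  by (rule generating_swap[OF generating_inv[OF generating_swap]])

lemma generating_mult:
  assumes "generating u v" shows "generating u (u \<cdot> v)"
proof (rule generating_trans[OF assms])
  have "inv\<^sub>F u \<cdot> (u \<cdot> v) \<in> generate F2 {u, u \<cdot> v}"
    by (intro generate.eng generate.inv generate.incl) auto
  then show "v \<in> generate F2 {u, u \<cdot> v}"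
    using assms by (simp add: generating_def flip: free.m_assoc)
qed (use assms in \<open>auto simp: generating_def intro: generate.incl\<close>)

lemma generating_mult_right:
  assumes "generating u v" shows "generating u (v \<cdot> u)"
proof -
  have c: "u \<in> carrier F2" "v \<in> carrier F2" using assms by (auto simp: generating_def)
  have "generating (inv\<^sub>F u) (inv\<^sub>F v)"
    by (rule generating_inv[OF generating_inv_left[OF assms]])
  then have "generating (inv\<^sub>F u) (inv\<^sub>F (v \<cdot> u))"
    using generating_mult c by (simp add: free.inv_mult_group)
  then have "generating (inv\<^sub>F (inv\<^sub>F u)) (inv\<^sub>F (inv\<^sub>F (v \<cdot> u)))"
    by (rule generating_inv[OF generating_inv_left])
  then show ?thesis using c by simp
qed

lemma generating_conj:
  assumes "generating u v" and g: "g \<in> carrier F2"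
  shows "generating (g \<cdot> u \<cdot> inv\<^sub>F g) (g \<cdot> v \<cdot> inv\<^sub>F g)"
proof -
  let ?c = "\<lambda>x. g \<cdot> x \<cdot> inv\<^sub>F g"
  interpret c: group_hom F2 F2 ?c
    using free.conj_hom[OF g] by (intro group_hom.intro group_hom_axioms.intro group_free_group)
  have "w \<in> ?c ` carrier F2" if "w \<in> carrier F2" for w
  proof
    show "w = ?c (inv\<^sub>F g \<cdot> w \<cdot> g)" using g that by (simp add: free.m_assoc flip: free.m_assoc[of g "inv\<^sub>F g"])
  qed (use g that in simp)
  then have "?c ` carrier F2 = carrier F2" using g by auto
  moreover have "generate F2 (?c ` {u, v}) = ?c ` generate F2 {u, v}"
    using assms by (intro c.generate_img) (auto simp: generating_def)
  ultimately show ?thesis using assms by (simp add: generating_def)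
qed

lemma basis_imp_generating: "basis u v \<Longrightarrow> generating u v"
proof (induction rule: basis.induct)
  case generators show ?case by (rule generating_generators)
next
  case swap show ?case by (rule generating_swap[OF swap.IH])
next
  case inv show ?case by (rule generating_inv[OF inv.IH])
next
  case mult show ?case by (rule generating_mult[OF mult.IH])
next
  case conj show ?case by (rule generating_conj[OF conj.IH conj.hyps(2)])
qed

text \<open>Powers of one element commute, whereas \<open>a\<close> and \<open>b\<close> do not.\<close>

lemma not_generate_singleton:
  assumes "u \<in> carrier F2" "a \<in> generate F2 {u}" "b \<in> generate F2 {u}" shows False
proof -
  obtain i j :: int where "a = u [^]\<^bsub>F2\<^esub> i" "b = u [^]\<^bsub>F2\<^esub> j"
    using assms by (auto simp: free.generate_pow)
  then have "a \<cdot> b = b \<cdot> a" using assms by (simp add: add.commute flip: free.int_pow_mult)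
  then show False by (simp add: free_group_def generator_def inv_letter_def)
qed

lemma generating_not_cyclic:
  assumes "generating u v" shows "v \<notin> generate F2 {u}"
proof
  assume "v \<in> generate F2 {u}"
  then have "generate F2 {u, v} \<subseteq> generate F2 {u}"
    using assms by (intro free.generate_subgroup_incl free.generate_is_subgroup)
      (auto simp: generating_def intro: generate.incl)
  then show False
    using assms not_generate_singleton[of u] by (auto simp: generating_def generator_closed subset_iff)
qed

text \<open>This is the one obstruction to Nielsen reducedness that multiplication does not remove: \<open>x\<close> is consumed
entirely in \<open>w x w\<close>, half of it on each side. Then \<open>x = p q\<^sup>-\<^sup>1\<close> and \<open>w = q s p\<^sup>-\<^sup>1\<close> with \<open>p\<close> and \<open>q\<close> of
the same length, so \<open>w x\<close> has the length of \<open>w\<close>, but it equals \<open>q s q\<^sup>-\<^sup>1\<close>, and conjugation by \<open>q\<close>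
shortens the pair of \<open>x\<close> and \<open>w x\<close>.\<close>

lemma conj_shortens:
  fixes w x :: "gen2 letter list"
  assumes c: "w \<in> carrier F2" "x \<in> carrier F2"
    and eq: "2 * lcp (inv\<^sub>F w) x = length x" "2 * lcp (inv\<^sub>F x) w = length x"
    and le: "length x \<le> length w" and pos: "0 < length x"
  shows "\<exists>q\<in>carrier F2. length (inv\<^sub>F q \<cdot> x \<cdot> q) + length (inv\<^sub>F q \<cdot> (w \<cdot> x) \<cdot> q) < length x + length w"
proof -
  define h where "h = lcp (inv\<^sub>F x) w"
  define q where "q = take h (inv\<^sub>F x)"
  define r where "r = drop h (inv\<^sub>F x)"
  have h: "lcp (inv\<^sub>F w) x = h" "length x = 2 * h" using eq by (auto simp: h_def)
  have "q @ r = inv\<^sub>F x" by (simp add: q_def r_def)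
  have split: "u \<in> carrier F2" "v \<in> carrier F2" "u \<cdot> v = y" if "u @ v = y" "y \<in> carrier F2" for u v y
    using that mult_eq_append[of u v] by (auto simp: carrier_iff reduced_iff_successively successively_append_iff)
  \<comment> \<open>Here \<open>inv r\<close> is the prefix \<open>p\<close> of \<open>x\<close>.\<close>
  note qr = split[OF \<open>q @ r = inv\<^sub>F x\<close> free.inv_closed[OF c(2)]]
  have qw: "q = take h w" unfolding q_def by (rule take_lcp) (simp add: h_def)
  have xq: "x \<cdot> q = inv\<^sub>F r"
  proof -
    have "x = inv\<^sub>F r \<cdot> inv\<^sub>F q"
      using arg_cong[OF qr(3), of "m_inv F2"] qr(1,2) c by (simp add: free.inv_mult_group)
    then have "x \<cdot> q = inv\<^sub>F r \<cdot> inv\<^sub>F q \<cdot> q" by simp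
    then show ?thesis using qr(1,2) by (simp add: free.m_assoc)
  qed
  define t where "t = drop h (inv\<^sub>F w)"
  have r_len: "length r = h" using c by (simp add: r_def length_inv h)
  have "inv\<^sub>F r = take h x"
  proof -
    have "x = flip (inv\<^sub>F x)" using inv_eq_flip[of "inv\<^sub>F x"] c by simp
    also have "\<dots> = flip r @ flip q" by (simp flip: \<open>q @ r = inv\<^sub>F x\<close>)
    finally show ?thesis using r_len qr by (simp add: inv_eq_flip)
  qed
  also have "\<dots> = take h (inv\<^sub>F w)" by (rule take_lcp) (use h(1) lcp_commute[of x "inv\<^sub>F w"] in simp)
  finally have "inv\<^sub>F r @ t = inv\<^sub>F w" by (simp add: t_def)
  note rt = split[OF this free.inv_closed[OF c(1)]]
  have wr: "w \<cdot> inv\<^sub>F r = inv\<^sub>F t"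
  proof -
    have "w = inv\<^sub>F t \<cdot> r"
      using arg_cong[OF rt(3), of "m_inv F2"] qr(2) rt(2) c by (simp add: free.inv_mult_group)
    then have "w \<cdot> inv\<^sub>F r = inv\<^sub>F t \<cdot> r \<cdot> inv\<^sub>F r" by simp
    then show ?thesis using qr(2) rt(2) by (simp add: free.m_assoc)
  qed
  have t_len: "length t = length w - h" using c by (simp add: t_def length_inv)
  have "q = take h (inv\<^sub>F t)"
  proof -
    have "w = flip (inv\<^sub>F w)" using inv_eq_flip[of "inv\<^sub>F w"] c by simp
    also have "\<dots> = flip t @ flip (inv\<^sub>F r)" by (simp flip: \<open>inv\<^sub>F r @ t = inv\<^sub>F w\<close>)
    finally show ?thesis using t_len rt qw le h(2) by (simp add: inv_eq_flip)
  qed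
  moreover define s where "s = drop h (inv\<^sub>F t)"
  ultimately have qt: "q @ s = inv\<^sub>F t" by simp
  note m = split[OF qt free.inv_closed[OF rt(2)]]
  have "inv\<^sub>F q \<cdot> inv\<^sub>F t = s"
    using m(2) qr(1) by (simp flip: m(3) free.m_assoc)
  then have u': "inv\<^sub>F q \<cdot> (w \<cdot> x) \<cdot> q = s"
    using c qr(1) xq wr by (simp add: free.m_assoc)
  have "length (inv\<^sub>F q \<cdot> inv\<^sub>F r) \<le> length q + length r"
    using length_mult[of "inv\<^sub>F q" "inv\<^sub>F r"] qr by (simp add: length_inv)
  then have "length (inv\<^sub>F q \<cdot> x \<cdot> q) \<le> length x"
    using c qr(1) xq r_len h by (simp add: free.m_assoc q_def length_inv)
  moreover have "length (inv\<^sub>F q \<cdot> (w \<cdot> x) \<cdot> q) < length w"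
    using u' rt(2) t_len h pos le by (simp add: length_inv s_def)
  ultimately show ?thesis using qr(1) by (intro bexI[of _ q]) auto
qed

lemma length_one_cases:
  assumes "length w \<le> 1" "w \<noteq> \<one>\<^bsub>F2\<^esub>"
  shows "w \<in> {a, inv\<^sub>F a, b, inv\<^sub>F b}"
proof -
  obtain g s where "w = [(g, s)]"
    using assms by (cases w) (auto simp: free_group_def)
  then show ?thesis by (cases g; cases s) (simp_all add: inv_generator, simp_all add: generator_def)
qed

text \<open>Nielsen's theorem in rank two. A counterexample \<open>(u, v)\<close> of minimal total length stays one (\<open>D\<close>) under
inversions and exchange, and no product or conjugation shortens it. Therefore \<open>u\<close>, \<open>v\<close> and their
inverses satisfy the hypotheses of \<open>nielsen_reduced_generate\<close>. The elements \<open>a\<close> and \<open>b\<close>, of length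
one, are then generated by those of \<open>u\<close> and \<open>v\<close> that have length one; one of them alone is not
enough, so \<open>u\<close> and \<open>v\<close> are letters after all.\<close>

lemma generating_imp_basis:
  "generating u v \<Longrightarrow> basis u v"
proof (induction "length u + length v" arbitrary: u v rule: less_induct)
  case less
  show ?case
  proof (rule ccontr)
    assume nb: "\<not> basis u v"
    define D where "D x y \<longleftrightarrow> generating x y \<and> \<not> basis x y \<and> length x + length y = length u + length v"
      for x y
    have D_carrier: "x \<in> carrier F2" "y \<in> carrier F2" if "D x y" for x y
      using that by (auto simp: D_def generating_def)
    have D_swap: "D y x" if "D x y" for x y
      using that generating_swap[of x y] basis.swap[of y x] by (auto simp: D_def)
    have D_inv: "D x (inv\<^sub>F y)" if "D x y" for x y
      using that D_carrier[OF that]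
      by (auto simp: D_def basis_inv_iff length_inv intro: generating_inv)
    have D_le: "length y \<le> length (x \<cdot> y)" if "D x y" for x y
    proof (rule ccontr)
      assume "\<not> ?thesis"
      then have "basis x (x \<cdot> y)"
        using that by (intro less(1)) (auto simp: D_def intro: generating_mult)
      then show False using that D_carrier[OF that] by (auto simp: D_def dest: basis_mult_cancel)
    qed
    have D_half: "2 * lcp (inv\<^sub>F x) y \<le> length x \<and> 2 * lcp (inv\<^sub>F x) y \<le> length y" if "D x y" for x y
    proof -
      note c = D_carrier[OF that]
      have "length (inv\<^sub>F (x \<cdot> y)) = length (x \<cdot> y)" using c by (simp add: length_inv)
      moreover have "length (inv\<^sub>F x) \<le> length (inv\<^sub>F y \<cdot> inv\<^sub>F x)"
        by (intro D_le D_inv D_swap[OF D_inv[OF D_swap]] D_swap[OF that])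
      ultimately show ?thesis
        using D_le[OF that] length_mult[OF c] c by (simp add: length_inv free.inv_mult_group)
    qed
    have D_turn: "2 * lcp (inv\<^sub>F w) x \<noteq> length x \<or> 2 * lcp (inv\<^sub>F x) w \<noteq> length x"
      if "D w x" "x \<noteq> \<one>\<^bsub>F2\<^esub>" for w x
    proof (rule ccontr)
      assume "\<not> ?thesis"
      moreover note c = D_carrier[OF that(1)]
      moreover have "length x \<le> length w" using D_half[OF that(1)] calculation by auto
      moreover have "0 < length x" using that(2) by (simp add: free_group_def)
      ultimately obtain q where q: "q \<in> carrier F2"
        "length (inv\<^sub>F q \<cdot> x \<cdot> q) + length (inv\<^sub>F q \<cdot> (w \<cdot> x) \<cdot> q) < length x + length w"
        using conj_shortens[of w x] by auto
      have "generating x (w \<cdot> x)"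
        using D_swap[OF that(1)] by (simp add: D_def generating_mult_right)
      from generating_conj[OF this, of "inv\<^sub>F q"] q(1)
      have "generating (inv\<^sub>F q \<cdot> x \<cdot> q) (inv\<^sub>F q \<cdot> (w \<cdot> x) \<cdot> q)" by simp
      then have "basis (inv\<^sub>F q \<cdot> x \<cdot> q) (inv\<^sub>F q \<cdot> (w \<cdot> x) \<cdot> q)"
        using that(1) q(2) by (intro less(1)) (auto simp: D_def)
      then have "basis x w"
        by (rule basis_mult_right_cancel[OF basis_conj_cancel]) (use c q(1) in auto)
      with D_swap[OF that(1)] show False by (simp add: D_def)
    qed
    have D: "D u v" using less nb by (simp add: D_def)
    note c = D_carrier[OF D]
    have u1: "u \<noteq> \<one>\<^bsub>F2\<^esub>" and v1: "v \<noteq> \<one>\<^bsub>F2\<^esub>"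
      using generating_not_cyclic[OF less(2)] generating_not_cyclic[OF generating_swap[OF less(2)]]
      by (auto intro: generate.one)
    define X where "X = {u, inv\<^sub>F u, v, inv\<^sub>F v}"
    have X: "X \<subseteq> carrier F2" "\<one>\<^bsub>F2\<^esub> \<notin> X" "\<And>x. x \<in> X \<Longrightarrow> inv\<^sub>F x \<in> X"
      using c u1 v1 by (auto simp: X_def eq_commute[of "\<one>\<^bsub>F2\<^esub>"] free.inv_eq_1_iff)
    have X_D: "y = x \<or> D x y" if "x \<in> X" "y \<in> X" "y \<noteq> inv\<^sub>F x" for x y
    proof -
      have D': "D u (inv\<^sub>F v)" "D (inv\<^sub>F u) v" "D (inv\<^sub>F u) (inv\<^sub>F v)"
        by (intro D_inv D_swap[OF D_inv[OF D_swap]] D)+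
      show ?thesis
        using that D D' D[THEN D_swap] D'[THEN D_swap] c by (auto simp: X_def)
    qed
    have X_self: "2 * lcp (inv\<^sub>F x) x < length x" if "x \<in> X" for x
      using lcp_inv_self_less[of x] that X by (auto simp: free_group_def)
    have half: "2 * lcp (inv\<^sub>F x) y \<le> length x \<and> 2 * lcp (inv\<^sub>F x) y \<le> length y"
      if "x \<in> X" "y \<in> X" "y \<noteq> inv\<^sub>F x" for x y
      using X_D[OF that] D_half[of x y] X_self[OF that(1)] by auto
    have core: "lcp (inv\<^sub>F w) x + lcp (inv\<^sub>F x) y < length x"
      if "w \<in> X" "x \<in> X" "y \<in> X" "x \<noteq> inv\<^sub>F w" "y \<noteq> inv\<^sub>F x" for w x y
    proof (rule ccontr)
      assume "\<not> ?thesis"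
      then have e: "2 * lcp (inv\<^sub>F w) x = length x" "2 * lcp (inv\<^sub>F x) y = length x"
        using half[OF that(1,2,4)] half[OF that(2,3,5)] by linarith+
      then have "x \<noteq> w" "y \<noteq> x" using X_self[OF that(2)] by auto
      then have "D w x" "D x y" using X_D that by blast+
      \<comment> \<open>Both neighbours of \<open>x\<close> come from the member of the pair that \<open>x\<close> does not come from.\<close>
      have "y = w \<or> y = inv\<^sub>F w"
        using that c \<open>x \<noteq> w\<close> \<open>y \<noteq> x\<close> unfolding X_def by auto
      then show False
      proof
        assume "y = w"
        then show False using D_turn[OF \<open>D w x\<close>] e X that by auto
      next
        assume y: "y = inv\<^sub>F w"
        have "min (lcp (inv\<^sub>F x) y) (lcp y x) \<le> lcp (inv\<^sub>F x) x" by (rule lcp_ultrametric)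
        then show False using e y X_self[OF that(2)] by simp
      qed
    qed
    let ?Y = "{x \<in> X. length x \<le> 1}"
    have gen: "g \<in> generate F2 ?Y" if "g \<in> carrier F2" "length g = 1" for g
    proof -
      have "generate F2 {u, v} \<subseteq> generate F2 X" by (rule free.mono_generate) (auto simp: X_def)
      then have "g \<in> generate F2 X" using that less(2) by (auto simp: generating_def)
      from nielsen_reduced_generate[OF X half core this] that show ?thesis by simp
    qed
    have "length a = 1" "length b = 1" by (simp_all add: generator_def)
    then have ab: "a \<in> generate F2 ?Y" "b \<in> generate F2 ?Y"
      using gen by (blast intro: generator_closed)+
    have short: "length x \<le> 1" if "x \<in> {u, v}" for x
    proof (rule ccontr)
      assume long: "\<not> length x \<le> 1"
      obtain y where y: "y \<in> carrier F2" "X = {x, inv\<^sub>F x, y, inv\<^sub>F y}"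
        using \<open>x \<in> {u, v}\<close> c by (auto simp: X_def)
      have "length (inv\<^sub>F x) = length x" using that c by (auto simp: length_inv)
      then have "?Y \<subseteq> generate F2 {y}" using long y by (auto intro: generate.incl generate.inv)
      then have "generate F2 ?Y \<subseteq> generate F2 {y}"
        using y by (intro free.generate_subgroup_incl free.generate_is_subgroup) auto
      then show False using ab not_generate_singleton[OF y(1)] by blast
    qed
    have "u \<in> {a, inv\<^sub>F a, b, inv\<^sub>F b}" "v \<in> {a, inv\<^sub>F a, b, inv\<^sub>F b}"
      by (rule length_one_cases[OF short]; simp add: u1 v1)+
    moreover have "v \<noteq> u" "v \<noteq> inv\<^sub>F u"
      using generating_not_cyclic[OF less(2)] by (auto intro: generate.incl generate.inv)
    ultimately show False
      using nb basis.generators basis.swap[OF basis.generators]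
      by (auto simp: basis_inv_iff generator_closed)
  qed
qed

section \<open>The groups generated by powers of primitive elements\<close>

lemma primitive_iff_basis: "primitive u \<longleftrightarrow> (\<exists>v. basis u v)"
proof
  assume "primitive u"
  then obtain S where S: "S \<subseteq> carrier F2" "card S = 2" "generate F2 S = carrier F2" "u \<in> S"
    by (auto simp: primitive_def)
  then obtain v where "S = {u, v}" by (auto simp: card_2_iff)
  with S have "generating u v" by (simp add: generating_def)
  then show "\<exists>v. basis u v" using generating_imp_basis by blast
next
  assume "\<exists>v. basis u v"
  then obtain v where v: "generating u v" using basis_imp_generating by blast
  moreover have "v \<noteq> u" using generating_not_cyclic[OF v] by (auto intro: generate.incl)
  ultimately show "primitive u"
    unfolding primitive_def generating_def by (intro exI[of _ "{u, v}"]) auto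
qed

lemma primitive_carrier: "primitive u \<Longrightarrow> u \<in> carrier F2"
  using basis_carrier by (auto simp: primitive_iff_basis)

lemma P_normal: "P k \<lhd> F2"
proof -
  let ?S = "{x \<up> k | x. primitive x}"
  have S: "?S \<subseteq> carrier F2" using primitive_carrier by auto
  have conj_P: "g \<cdot> w \<cdot> inv\<^sub>F g \<in> P k" if "w \<in> P k" and g: "g \<in> carrier F2" for w g
  proof -
    let ?c = "\<lambda>x. g \<cdot> x \<cdot> inv\<^sub>F g"
    interpret c: group_hom F2 F2 ?c
      using free.conj_hom[OF g] by (intro group_hom.intro group_hom_axioms.intro group_free_group)
    have "?c ` ?S \<subseteq> ?S"
    proof (clarify)
      fix x assume x: "primitive x"
      then have "primitive (?c x)" using g by (auto simp: primitive_iff_basis intro: basis.conj)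
      moreover have "?c (x \<up> k) = ?c x \<up> k"
        using c.hom_nat_pow primitive_carrier[OF x] by blast
      ultimately show "\<exists>y. ?c (x \<up> k) = y \<up> k \<and> primitive y" by blast
    qed
    then have "generate F2 (?c ` ?S) \<subseteq> P k" unfolding P_def by (rule free.mono_generate)
    then have "?c ` P k \<subseteq> P k" using c.generate_img[OF S] unfolding P_def by simp
    then show ?thesis using \<open>w \<in> P k\<close> by blast
  qed
  have "subgroup (P k) F2" unfolding P_def by (rule free.generate_is_subgroup[OF S])
  then show ?thesis using conj_P by (auto simp: free.normal_inv_iff)
qed

lemma P_eq_normal_closure:
  assumes prim: "\<And>w. w \<in> W \<Longrightarrow> primitive w"
    and least: "\<And>N u v. \<lbrakk>N \<lhd> F2; \<forall>w\<in>W. w \<up> k \<in> N; basis u v\<rbrakk> \<Longrightarrow> u \<up> k \<in> N"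
  shows "P k = normal_closure F2 ((\<lambda>w. w \<up> k) ` W)"
proof
  show "normal_closure F2 ((\<lambda>w. w \<up> k) ` W) \<subseteq> P k"
    unfolding normal_closure_def
    using P_normal prim by (intro Inter_lower) (auto simp: P_def intro: generate.incl)
  show "P k \<subseteq> normal_closure F2 ((\<lambda>w. w \<up> k) ` W)"
    unfolding normal_closure_def
  proof (rule Inter_greatest, clarify)
    fix N x assume "x \<in> P k" and N: "N \<lhd> F2" "(\<lambda>w. w \<up> k) ` W \<subseteq> N"
    have "\<forall>w\<in>W. w \<up> k \<in> N" using N(2) by blast
    then have "u \<up> k \<in> N" if "basis u v" for u v using least[OF N(1) _ that] by blast
    then have "{x \<up> k | x. primitive x} \<subseteq> N" unfolding primitive_iff_basis by blast
    then have "P k \<subseteq> N" unfolding P_def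
      using N(1) by (intro free.generate_subgroup_incl normal_imp_subgroup)
    then show "x \<in> N" using \<open>x \<in> P k\<close> by blast
  qed
qed

text \<open>The common part of the four cases. The function \<open>slopes\<close> is applied to the quotients \<open>F2 Mod N\<close> only,
which fixes its type; \<open>W\<close> stands for the same words in \<open>F2\<close>.\<close>

locale slope_words =
  fixes k :: nat and W :: "gen2 letter list set"
    and slopes :: "gen2 letter list set monoid \<Rightarrow> gen2 letter list set \<Rightarrow> gen2 letter list set
      \<Rightarrow> gen2 letter list set set"
  assumes primitive_words: "w \<in> W \<Longrightarrow> primitive w"
    and base: "group_hom F2 H h \<Longrightarrow> slopes H (h a) (h b) = h ` W"
    and hom: "\<lbrakk>group_hom H H f; x \<in> carrier H; y \<in> carrier H\<rbrakk>
      \<Longrightarrow> slopes H (f x) (f y) = f ` slopes H x y"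
    and first: "x \<in> slopes H x y"
    and moves: "\<lbrakk>group H; \<forall>w\<in>slopes H x y. group.tor H k w\<rbrakk>
      \<Longrightarrow> (\<forall>w\<in>slopes H y x. group.tor H k w) \<and> (\<forall>w\<in>slopes H x (inv\<^bsub>H\<^esub> y). group.tor H k w) \<and>
        (\<forall>w\<in>slopes H x (x \<otimes>\<^bsub>H\<^esub> y). group.tor H k w)"
begin

lemma P_eq: "P k = normal_closure F2 ((\<lambda>w. w \<up> k) ` W)"
proof (rule P_eq_normal_closure)
  fix N u v
  assume N: "N \<lhd> F2" and W: "\<forall>w\<in>W. w \<up> k \<in> N" and uv: "basis u v"
  define H where "H = F2 Mod N"
  define h where "h = (\<lambda>x. N #>\<^bsub>F2\<^esub> x)"
  interpret normal N F2 by fact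
  interpret H: group H unfolding H_def by (rule factorgroup_is_group)
  have h: "h \<in> hom F2 H" unfolding h_def H_def by (rule r_coset_hom_Mod)
  interpret h: group_hom F2 H h
    by (intro group_hom.intro group_hom_axioms.intro group_free_group H.is_group h)
  have pow: "h x [^]\<^bsub>H\<^esub> k = \<one>\<^bsub>H\<^esub> \<longleftrightarrow> x \<up> k \<in> N" if "x \<in> carrier F2" for x
  proof -
    have "h x [^]\<^bsub>H\<^esub> k = h (x \<up> k)" using that by (simp add: h.hom_nat_pow)
    moreover have "\<one>\<^bsub>H\<^esub> = N" by (simp add: H_def FactGroup_def)
    moreover have "N #>\<^bsub>F2\<^esub> (x \<up> k) = N \<longleftrightarrow> x \<up> k \<in> N"
      using free.coset_join1[OF _ _ subgroup_axioms] free.coset_join2[OF _ subgroup_axioms] that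
      by (metis free.nat_pow_closed)
    ultimately show ?thesis by (simp add: h_def)
  qed
  have "\<forall>w\<in>slopes H (h u) (h v). H.tor k w"
    using uv
  proof induction
    case generators
    show ?case using W pow primitive_carrier[OF primitive_words]
      by (auto simp: base[OF h.group_hom_axioms] H.tor_def)
  next
    case (swap u v)
    show ?case using moves[OF H.is_group swap.IH] by blast
  next
    case (inv u v)
    show ?case using moves[OF H.is_group inv.IH] basis_carrier[OF inv.hyps] by simp
  next
    case (mult u v)
    show ?case using moves[OF H.is_group mult.IH] basis_carrier[OF mult.hyps] by simp
  next
    case (conj u v g)
    let ?c = "\<lambda>x. h g \<otimes>\<^bsub>H\<^esub> x \<otimes>\<^bsub>H\<^esub> inv\<^bsub>H\<^esub> h g"
    interpret c: group_hom H H ?c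
      by (intro group_hom.intro group_hom_axioms.intro H.is_group H.conj_hom h.hom_closed conj.hyps)
    have "slopes H (h (g \<cdot> u \<cdot> inv\<^sub>F g)) (h (g \<cdot> v \<cdot> inv\<^sub>F g)) = ?c ` slopes H (h u) (h v)"
      using hom[OF c.group_hom_axioms, of "h u" "h v"] basis_carrier[OF conj.hyps(1)] conj.hyps(2) by simp
    moreover have "H.tor k (?c w)" if "H.tor k w" for w
      using that c.hom_nat_pow[of w k] by (simp add: H.tor_def)
    ultimately show ?case using conj.IH by auto
  qed
  then have "H.tor k (h u)" using first by blast
  then show "u \<up> k \<in> N" using pow basis_carrier[OF uv] by (simp add: H.tor_def)
qed (rule primitive_words)

end

lemma basis_mult_right:
  assumes "basis u v" shows "basis u (v \<cdot> u)"
proof -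
  have "basis (inv\<^sub>F (inv\<^sub>F u)) (inv\<^sub>F (inv\<^sub>F u \<cdot> inv\<^sub>F v))"
    by (rule basis_inv_left[OF basis.inv[OF basis.mult[OF basis_inv_left[OF basis.inv[OF assms]]]]])
  then show ?thesis using basis_carrier[OF assms] by (simp add: free.inv_mult_group)
qed

lemma basis_primitive: "basis u v \<Longrightarrow> primitive v"
  using basis.swap[of u v] by (auto simp: primitive_iff_basis)

text \<open>Each word is the second member of an explicit basis; for example
\<open>a\<^sup>3 b a\<^sup>2 b = a (a\<^sup>2 b)\<^sup>2\<close> comes from \<open>(a\<^sup>2 b, a)\<close>. The lists for smaller \<open>k\<close> are contained in this one.\<close>

lemma slopes5_primitive:
  assumes "w \<in> slopes5 F2 a b" shows "primitive w"
proof -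
  let ?B = "inv\<^sub>F b"
  have c [simp]: "a \<in> carrier F2" "b \<in> carrier F2" by (simp_all add: generator_closed)
  note n = free.m_assoc free.pow_words free.inv_mult_group
  note ab = basis.generators
  have aB: "basis a ?B" and ba: "basis b a" and Ba: "basis ?B a"
    by (rule basis.inv[OF ab] basis.swap[OF ab] basis.swap[OF basis.inv[OF ab]])+
  note x1 = basis.mult[OF ab] basis.mult[OF aB] basis_mult_right[OF ba] basis_mult_right[OF Ba]
  note x2 = basis.mult[OF x1(1)] basis.mult[OF x1(2)] basis_mult_right[OF x1(3)] basis_mult_right[OF x1(4)]
  note y1 = basis_mult_right[OF basis_mult_right[OF basis.swap[OF x1(1)]]]
    basis.mult[OF basis.mult[OF basis.swap[OF x1(4)]]]
    basis_mult_right[OF basis_mult_right[OF basis.swap[OF x2(1)]]]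
    basis.mult[OF basis.mult[OF basis.swap[OF x2(4)]]]
  note p = ab ba x1 x2 y1
  note q = p[THEN basis_primitive]
  show ?thesis using assms q unfolding slopes5_def by (auto simp: n)
qed

theorem mainTheorem8:
  shows "P 2 = normal_closure F2 {a \<up> 2, b \<up> 2, (a \<cdot> b) \<up> 2} \<and>
     P 3 = normal_closure F2
           {a \<up> 3, b \<up> 3, (a \<cdot> b) \<up> 3, (a \<cdot> inv\<^sub>F b) \<up> 3} \<and>
     P 4 = normal_closure F2
           {a \<up> 4, b \<up> 4, (a \<cdot> b) \<up> 4, (a \<cdot> inv\<^sub>F b) \<up> 4,
            (a \<up> 2 \<cdot> b) \<up> 4, (a \<cdot> b \<up> 2) \<up> 4} \<and>
     P 5 = normal_closure F2
           {a \<up> 5, b \<up> 5, (a \<cdot> b) \<up> 5, (a \<cdot> inv\<^sub>F b) \<up> 5,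
            (a \<up> 2 \<cdot> b) \<up> 5, (a \<cdot> b \<up> 2) \<up> 5,
            (a \<up> 2 \<cdot> inv\<^sub>F b) \<up> 5, (a \<cdot> (inv\<^sub>F b) \<up> 2) \<up> 5,
            (a \<up> 2 \<cdot> b \<cdot> a \<cdot> b) \<up> 5,
            (a \<cdot> inv\<^sub>F b \<cdot> a \<cdot> (inv\<^sub>F b) \<up> 2) \<up> 5,
            (a \<up> 3 \<cdot> b \<cdot> a \<up> 2 \<cdot> b) \<up> 5,
            (a \<cdot> (inv\<^sub>F b) \<up> 2 \<cdot> a \<cdot> (inv\<^sub>F b) \<up> 3) \<up> 5}"
proof -
  have sub: "slopes2 F2 a b \<subseteq> slopes5 F2 a b" "slopes3 F2 a b \<subseteq> slopes5 F2 a b"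
    "slopes4 F2 a b \<subseteq> slopes5 F2 a b"
    by (auto simp: slopes2_def slopes3_def slopes4_def slopes5_def)
  have "slope_words 2 (slopes2 F2 a b) slopes2"
    by (rule slope_words.intro, rule slopes5_primitive, erule subsetD[OF sub(1)],
        erule slopes_hom(1), (rule generator_closed)+, erule (2) slopes_hom(1),
        simp add: slopes2_def, (intro conjI; erule (1) group.slopes2_moves))
  then have 2: "P 2 = normal_closure F2 ((\<lambda>w. w \<up> 2) ` slopes2 F2 a b)" by (rule slope_words.P_eq)
  have "slope_words 3 (slopes3 F2 a b) slopes3"
    by (rule slope_words.intro, rule slopes5_primitive, erule subsetD[OF sub(2)],
        erule slopes_hom(2), (rule generator_closed)+, erule (2) slopes_hom(2),
        simp add: slopes3_def, (intro conjI; erule (1) group.slopes3_moves))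
  then have 3: "P 3 = normal_closure F2 ((\<lambda>w. w \<up> 3) ` slopes3 F2 a b)" by (rule slope_words.P_eq)
  have "slope_words 4 (slopes4 F2 a b) slopes4"
    by (rule slope_words.intro, rule slopes5_primitive, erule subsetD[OF sub(3)],
        erule slopes_hom(3), (rule generator_closed)+, erule (2) slopes_hom(3),
        simp add: slopes4_def, (intro conjI; erule (1) group.slopes4_moves))
  then have 4: "P 4 = normal_closure F2 ((\<lambda>w. w \<up> 4) ` slopes4 F2 a b)" by (rule slope_words.P_eq)
  have "slope_words 5 (slopes5 F2 a b) slopes5"
    by (rule slope_words.intro, rule slopes5_primitive, assumption,
        erule slopes_hom(4), (rule generator_closed)+, erule (2) slopes_hom(4),
        simp add: slopes5_def, (intro conjI; erule (1) group.slopes5_moves))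
  then have 5: "P 5 = normal_closure F2 ((\<lambda>w. w \<up> 5) ` slopes5 F2 a b)" by (rule slope_words.P_eq)
  show ?thesis
    using 2 3 4 5 unfolding slopes2_def slopes3_def slopes4_def slopes5_def image_insert image_empty
    by (intro conjI)
qed

end
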